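(* Let $K$ be an algebraically closed field which is complete with respect to a non-trivial non-archimedean absolute value $|\cdot|$, let $p\geq 0$ be its residue characteristic, let $d\geq 2$ be an integer, and assume that either $\operatorname{char}K=0$ or $\operatorname{char}K>d$. Define $\epsilon=\epsilon_{p,d}=\min\{|m|^d : 1\leq m\leq d\}$ (where $|m|$ is the absolute value of the integer $m$ viewed in $K$). Let $\varphi\in K(z)$ be a rational function of degree $d$ and let $\gamma\in\mathbb{P}^1(K)$ be a fixed point of $\varphi$ satisfying $0<|\varphi'(\gamma)|<\epsilon$. Then there is a critical point of $\varphi$ which is strictly attracted to $\gamma$.
   Context: The multiplier $\varphi'(\gamma)$ of a fixed point is computed in a coordinate in which $\gamma\neq\infty$ (it is independent of the coordinate). Critical points are taken in $\mathbb{P}^1(K)$. A fixed point $\gamma$ attracts $x\in\mathbb{P}^1(K)$ if $\varphi^n(x)\to\gamma$ as $n\to\infty$, and strictly attracts $x$ if it attracts $x$ and $\varphi^l(x)\neq\gamma$ for all $l\geq 1$. Here $\varphi^n$ is the $n$-fold composition. *)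

theory Defs
  imports
    "HOL-Computational_Algebra.Polynomial"
    "HOL-Computational_Algebra.Fraction_Field"
    "HOL-Analysis.Abstract_Metric_Spaces"
begin

section \<open>Non-archimedean absolute values\<close>

locale nonarch_absolute_value =
  fixes v :: "'a :: field \<Rightarrow> real"
  assumes nonneg: "v x \<ge> 0"
    and eq_0_iff: "v x = 0 \<longleftrightarrow> x = 0"
    and mult: "v (x * y) = v x * v y"
    and ultrametric: "v (x + y) \<le> max (v x) (v y)"
begin

lemma one: "v 1 = 1"
  using mult[of 1 1] eq_0_iff[of 1] by simp

lemma minus: "v (- x) = v x"
proof -
  have "v (- 1) * v (- 1) = 1"
    using mult[of "- 1" "- 1"] one by simp
  hence "v (- 1) = 1"
    using nonneg[of "- 1"] by (metis abs_of_nonneg real_sqrt_abs2 real_sqrt_one)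
  thus ?thesis using mult[of "- 1" x] by simp
qed

lemma metric_space: "Metric_space UNIV (\<lambda>x y. v (x - y))"
proof
  fix x y z
  show "v (x - y) = v (y - x)" using minus[of "x - y"] by simp
  have "v (x - z) \<le> max (v (x - y)) (v (y - z))"
    using ultrametric[of "x - y" "y - z"] by simp
  thus "v (x - z) \<le> v (x - y) + v (y - z)"
    using nonneg[of "x - y"] nonneg[of "y - z"] by linarith
qed (auto simp: nonneg eq_0_iff)

end

definition nontrivial_absolute_value :: "('a :: field \<Rightarrow> real) \<Rightarrow> bool" where
  "nontrivial_absolute_value v \<longleftrightarrow> (\<exists>x. x \<noteq> 0 \<and> v x \<noteq> 1)"

definition complete_absolute_value :: "('a :: field \<Rightarrow> real) \<Rightarrow> bool" where
  "complete_absolute_value v \<longleftrightarrow> Metric_space.mcomplete UNIV (\<lambda>x y. v (x - y))"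

text \<open>The characteristic of the residue field \<open>{x. v x \<le> 1} / {x. v x < 1}\<close>: an integer
  vanishes in it iff its absolute value is \<open>< 1\<close>; cf. the definition of \<open>semiring_char\<close>.\<close>
definition residue_char :: "('a :: field \<Rightarrow> real) \<Rightarrow> nat" where
  "residue_char v = Gcd {n. v (of_nat n) < 1}"

definition eps :: "('a :: field \<Rightarrow> real) \<Rightarrow> nat \<Rightarrow> real" where
  "eps v d = Min ((\<lambda>m. v (of_nat m) ^ d) ` {1..d})"


section \<open>The projective line\<close>

datatype 'a proj_line = Fin 'a | Infty

fun hom_coords :: "'a :: field proj_line \<Rightarrow> 'a \<times> 'a" where
  "hom_coords (Fin a) = (a, 1)"
| "hom_coords Infty = (1, 0)"

text \<open>The chordal (spherical) metric, which induces the topology of \<open>\<bbbP>\<^sup>1(K)\<close>.\<close>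
definition chordal :: "('a :: field \<Rightarrow> real) \<Rightarrow> 'a proj_line \<Rightarrow> 'a proj_line \<Rightarrow> real" where
  "chordal v x y = (case (hom_coords x, hom_coords y) of ((x0, x1), (y0, y1)) \<Rightarrow>
     v (x0 * y1 - y0 * x1) / (max (v x0) (v x1) * max (v y0) (v y1)))"

lemma (in nonarch_absolute_value) chordal_ultrametric:
  "chordal v x z \<le> max (chordal v x y) (chordal v y z)"
proof -
  obtain x0 x1 y0 y1 z0 z1 where c:
    "hom_coords x = (x0, x1)" "hom_coords y = (y0, y1)" "hom_coords z = (z0, z1)"
    by (meson surj_pair)
  have pos: "max (v a) (v b) > 0" if "hom_coords u = (a, b)" for u a b
    using that by (cases u) (auto simp: one less_max_iff_disj)
  define X Y Z where "X = max (v x0) (v x1)" and "Y = max (v y0) (v y1)"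
    and "Z = max (v z0) (v z1)"
  have XYZ: "X > 0" "Y > 0" "Z > 0"
    using pos c unfolding X_def Y_def Z_def by blast+
  define A B C where "A = v (x0 * y1 - y0 * x1)" and "B = v (y0 * z1 - z0 * y1)"
    and "C = v (x0 * z1 - z0 * x1)"
  have nn: "A \<ge> 0" "B \<ge> 0" by (auto simp: A_def B_def nonneg)
  have bound: "C * v yi \<le> max (B * X) (A * Z)"
    if "(yi = y0 \<and> xi = x0 \<and> zi = z0) \<or> (yi = y1 \<and> xi = x1 \<and> zi = z1)" for xi yi zi
  proof -
    have "(x0 * z1 - z0 * x1) * yi
        = (y0 * z1 - z0 * y1) * xi + (x0 * y1 - y0 * x1) * zi"
      using that by (auto simp: algebra_simps)
    hence "C * v yi \<le> max (B * v xi) (A * v zi)"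
      using ultrametric unfolding A_def B_def C_def by (metis mult)
    moreover have "B * v xi \<le> B * X" "A * v zi \<le> A * Z"
      using that nn unfolding X_def Z_def by (auto intro!: mult_left_mono)
    ultimately show ?thesis by linarith
  qed
  have "C * Y \<le> max (B * X) (A * Z)"
    using bound[of y0 x0 z0] bound[of y1 x1 z1] unfolding Y_def
    by (cases "v y0 \<le> v y1") (simp_all add: max_absorb1 max_absorb2)
  hence "C * Y \<le> B * X \<or> C * Y \<le> A * Z" by (auto simp: le_max_iff_disj)
  hence "C / (X * Z) \<le> B / (Y * Z) \<or> C / (X * Z) \<le> A / (X * Y)"
    using XYZ by (simp add: divide_simps mult.commute)
  hence "C / (X * Z) \<le> max (A / (X * Y)) (B / (Y * Z))" by (auto simp: le_max_iff_disj)
  thus ?thesis by (simp add: chordal_def c A_def B_def C_def X_def Y_def Z_def)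
qed

lemma (in nonarch_absolute_value) Metric_space_chordal: "Metric_space UNIV (chordal v)"
proof
  have nn: "chordal v x y \<ge> 0" for x y
    by (auto simp: chordal_def nonneg le_max_iff_disj split: prod.split)
  show "0 \<le> chordal v x y" for x y by (rule nn)
  show "chordal v x y = chordal v y x" for x y
  proof -
    have "v (a - b) = v (b - a)" for a b using minus[of "a - b"] by simp
    thus ?thesis by (auto simp: chordal_def mult.commute split: prod.split)
  qed
  show "chordal v x y = 0 \<longleftrightarrow> x = y" for x y
  proof -
    have "max (v a) 1 \<noteq> 0" for a by (simp add: max_def)
    moreover have "v 0 = 0" using eq_0_iff by simp
    ultimately show ?thesis
      by (cases x; cases y) (auto simp: chordal_def one eq_0_iff)
  qed
  show "chordal v x z \<le> chordal v x y + chordal v y z" for x y z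
    using chordal_ultrametric[of x z y] nn[of x y] nn[of y z] by linarith
qed


section \<open>Rational functions\<close>

definition lowest_terms :: "'a :: field poly fract \<Rightarrow> 'a poly \<times> 'a poly \<Rightarrow> bool" where
  "lowest_terms f pq \<longleftrightarrow> snd pq \<noteq> 0 \<and> coprime (fst pq) (snd pq) \<and> f = Fract (fst pq) (snd pq)"

lemma lowest_terms_exists: "\<exists>pq. lowest_terms f pq"
proof -
  define P where "P q \<longleftrightarrow> q \<noteq> 0 \<and> (\<exists>p. f = Fract p q)" for q
  have "\<exists>q. P q" unfolding P_def by (cases f) auto
  then obtain q where q: "P q" and min: "\<And>r. P r \<Longrightarrow> degree q \<le> degree r"
    using exists_least_iff[of "\<lambda>n. \<exists>q. P q \<and> degree q = n"] by (metis linorder_not_less)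
  from q obtain p where p: "q \<noteq> 0" "f = Fract p q" unfolding P_def by auto
  have "coprime p q"
  proof (rule coprimeI)
    fix c assume "c dvd p" "c dvd q"
    then obtain a b where ab: "p = c * a" "q = c * b" by (auto elim!: dvdE)
    with p have nz: "c \<noteq> 0" "b \<noteq> 0" by auto
    have "f = Fract a b" using p ab nz by (simp add: eq_fract algebra_simps)
    hence "P b" using nz unfolding P_def by auto
    from min[OF this] have "degree c = 0" using ab nz by (simp add: degree_mult_eq)
    thus "is_unit c" using nz by (simp add: is_unit_iff_degree)
  qed
  thus ?thesis using p unfolding lowest_terms_def by (intro exI[of _ "(p, q)"]) auto
qed

text \<open>The representation in lowest terms is unique only up to a common constant factor.
  None of the notions below depends on the choice.\<close>
definition rat_num :: "'a :: field poly fract \<Rightarrow> 'a poly" where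
  "rat_num f = fst (SOME pq. lowest_terms f pq)"

definition rat_den :: "'a :: field poly fract \<Rightarrow> 'a poly" where
  "rat_den f = snd (SOME pq. lowest_terms f pq)"

lemma lowest_terms_rat: "lowest_terms f (rat_num f, rat_den f)"
  unfolding rat_num_def rat_den_def using lowest_terms_exists[of f] by (simp add: someI_ex)

definition rat_degree :: "'a :: field poly fract \<Rightarrow> nat" where
  "rat_degree f = max (degree (rat_num f)) (degree (rat_den f))"

definition rat_eval :: "'a :: field poly fract \<Rightarrow> 'a \<Rightarrow> 'a proj_line" where
  "rat_eval f a = (if poly (rat_den f) a = 0 then Infty
     else Fin (poly (rat_num f) a / poly (rat_den f) a))"

text \<open>The rational function \<open>f(1/z)\<close>. Recall \<open>reflect_poly p = z\<^bsup>degree p\<^esup> p(1/z)\<close>.\<close>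
definition rat_flip :: "'a :: field poly fract \<Rightarrow> 'a poly fract" where
  "rat_flip f = (let p = rat_num f; q = rat_den f in
     Fract (reflect_poly p * monom 1 (degree q)) (reflect_poly q * monom 1 (degree p)))"

fun rat_map :: "'a :: field poly fract \<Rightarrow> 'a proj_line \<Rightarrow> 'a proj_line" where
  "rat_map f (Fin a) = rat_eval f a"
| "rat_map f Infty = rat_eval (rat_flip f) 0"

text \<open>Meaningful only if \<open>f\<close> has no pole at \<open>a\<close>.\<close>
definition rat_deriv :: "'a :: field poly fract \<Rightarrow> 'a \<Rightarrow> 'a" where
  "rat_deriv f a = (let p = rat_num f; q = rat_den f in
     poly (pderiv p * q - p * pderiv q) a / poly q a ^ 2)"

text \<open>The derivative of \<open>f\<close> at \<open>x\<close>, where the coordinate \<open>1/z\<close> instead of \<open>z\<close> is used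
  on the source if \<open>x = \<infinity>\<close>, and on the target if \<open>f(x) = \<infinity>\<close>.\<close>
definition local_deriv :: "'a :: field poly fract \<Rightarrow> 'a proj_line \<Rightarrow> 'a" where
  "local_deriv f x =
     (let (g, a) = (case x of Fin a \<Rightarrow> (f, a) | Infty \<Rightarrow> (rat_flip f, 0));
          h = (if rat_map f x = Infty then inverse g else g)
      in rat_deriv h a)"

definition critical_point :: "'a :: field poly fract \<Rightarrow> 'a proj_line \<Rightarrow> bool" where
  "critical_point f c \<longleftrightarrow> local_deriv f c = 0"

definition fixed_point :: "'a :: field poly fract \<Rightarrow> 'a proj_line \<Rightarrow> bool" where
  "fixed_point f x \<longleftrightarrow> rat_map f x = x"

text \<open>At a fixed point \<open>x\<close>, \<open>local_deriv\<close> uses the same coordinate on source and target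
  (\<open>z\<close> if \<open>x\<close> is finite, \<open>1/z\<close> if \<open>x = \<infinity>\<close>), so it is the multiplier.\<close>
abbreviation multiplier :: "'a :: field poly fract \<Rightarrow> 'a proj_line \<Rightarrow> 'a" where
  "multiplier \<equiv> local_deriv"

definition attracts ::
    "('a :: field \<Rightarrow> real) \<Rightarrow> 'a poly fract \<Rightarrow> 'a proj_line \<Rightarrow> 'a proj_line \<Rightarrow> bool" where
  "attracts v f g x \<longleftrightarrow>
     limitin (Metric_space.mtopology UNIV (chordal v)) (\<lambda>n. (rat_map f ^^ n) x) g sequentially"

definition strictly_attracts ::
    "('a :: field \<Rightarrow> real) \<Rightarrow> 'a poly fract \<Rightarrow> 'a proj_line \<Rightarrow> 'a proj_line \<Rightarrow> bool" where
  "strictly_attracts v f g x \<longleftrightarrow> attracts v f g x \<and> (\<forall>l\<ge>1. (rat_map f ^^ l) x \<noteq> g)"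

end

theory Submission
  imports Defs
begin

text \<open>Move the fixed point to \<open>\<infinity>\<close> and another fixed point to \<open>0\<close>, so that the map is \<open>Q/P\<close> with
  \<open>deg Q = d\<close>, \<open>deg P = d - 1\<close>, \<open>Q(0) = 0\<close>, and multiplier \<open>\<lambda>\<close> equal to the quotient of the leading
  coefficients of \<open>P\<close> and \<open>Q\<close>. Let \<open>R\<close> be the largest absolute value of a root of \<open>P Q\<close>. For \<open>\<bar>z\<bar> > R\<close> one has
  \<open>\<bar>Q/P(z)\<bar> = \<bar>z\<bar>/\<bar>\<lambda>\<bar>\<close>, so a critical point \<open>c\<close> with \<open>\<bar>Q/P(c)\<bar> > R\<close> and \<open>P(c) \<noteq> 0\<close> is strictly attracted
  to \<open>\<infinity>\<close>. Suppose there is none, and consider the logarithmic differential \<open>d(Q/P)/(Q/P) = W/(P Q) dz\<close>,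
  where \<open>W = Q' P - Q P'\<close>. It has simple poles at the roots of \<open>P Q\<close>, and \<open>P Q\<close> has exactly one root more
  than \<open>W\<close>, while these roots occupy at least two residue classes of the disc of radius \<open>R\<close>. So some class
  contains at least as many roots of \<open>W\<close> as of \<open>P Q\<close>. Descending through such classes until \<open>\<bar>Q/P\<bar> \<le> R\<close>,
  one finds a disc of radius \<open>s\<close> on which the Gauss norms satisfy \<open>\<bar>W/(P Q)\<bar> \<le> 1/R\<close> and whose degree
  \<open>k = #roots of Q - #roots of P\<close> is between \<open>1\<close> and \<open>d\<close>. Since the constant term of the Laurent expansion of
  \<open>z W/(P Q)\<close> around the disc is \<open>k\<close>, also \<open>s \<bar>W/(P Q)\<bar> \<ge> \<bar>k\<bar>\<close>, so \<open>s/R \<ge> \<bar>k\<bar>\<close>. During the descent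
  \<open>\<bar>Q/P\<bar>\<close> drops from \<open>R/\<bar>\<lambda>\<bar>\<close> to at most \<open>R\<close>, but by a factor of at most \<open>(R/s)\<^sup>d\<close>; hence \<open>\<bar>\<lambda>\<bar> \<ge> \<bar>k\<bar>\<^sup>d \<ge> \<epsilon>\<close>.\<close>

section \<open>Polynomials and Wronskians\<close>

lemma coeff_mult_le_degrees:
  fixes p q :: "'b :: comm_semiring_1 poly"
  assumes "degree p \<le> m" "degree q \<le> n"
  shows "coeff (p * q) (m + n) = coeff p m * coeff q n"
proof -
  have "coeff p i * coeff q (m + n - i) = 0" if "i \<noteq> m" "i \<le> m + n" for i
    using that assms by (cases "i < m") (auto simp: coeff_eq_0)
  then have "(\<Sum>i\<le>m + n. coeff p i * coeff q (m + n - i)) = (\<Sum>i\<in>{m}. coeff p i * coeff q (m + n - i))"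
    by (intro sum.mono_neutral_right) auto
  then show ?thesis by (simp add: coeff_mult)
qed

text \<open>The numerator of the derivative of \<open>q / p\<close>. Divided by \<open>p * q\<close>
  it is the logarithmic derivative of \<open>q / p\<close>.\<close>

definition wronskian :: "'b :: idom poly \<Rightarrow> 'b poly \<Rightarrow> 'b poly" where
  "wronskian q p = pderiv q * p - q * pderiv p"

text \<open>The operator \<open>z d/dz\<close> multiplies the coefficient of \<open>z^i\<close> by
  \<open>i\<close>, so it keeps degree bounds. This is why the Wronskian is multiplied by
  \<open>z\<close>.\<close>

lemma coeff_x_mult_wronskian:
  assumes "degree q \<le> m" "degree p \<le> n"
  shows "coeff ([:0, 1:] * wronskian q p) (m + n) = (of_nat m - of_nat n) * (coeff q m * coeff p n)"
    and "degree ([:0, 1:] * wronskian q p) \<le> m + n"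
proof -
  let ?D = "\<lambda>f. [:0, 1:] * pderiv f"
  have coeff: "coeff (?D f) i = of_nat i * coeff f i" for f :: "'a poly" and i
    by (cases i) (auto simp: coeff_pderiv)
  then have deg: "degree (?D f) \<le> l" if "degree f \<le> l" for f :: "'a poly" and l
    using that by (intro degree_le) (auto simp: coeff_eq_0)
  have eq: "[:0, 1:] * wronskian q p = ?D q * p - q * ?D p"
    by (simp add: wronskian_def algebra_simps)
  show "coeff ([:0, 1:] * wronskian q p) (m + n) = (of_nat m - of_nat n) * (coeff q m * coeff p n)"
    unfolding eq coeff_diff coeff_mult_le_degrees[OF deg[OF assms(1)] assms(2)]
      coeff_mult_le_degrees[OF assms(1) deg[OF assms(2)]] coeff
    by (simp add: algebra_simps)
  show "degree ([:0, 1:] * wronskian q p) \<le> m + n"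
    unfolding eq by (intro degree_diff_le order.trans[OF degree_mult_le] add_mono deg assms)
qed

lemma coprime_iff_no_common_root:
  fixes p q :: "'b :: alg_closed_field poly"
  assumes "p \<noteq> 0"
  shows "coprime p q \<longleftrightarrow> (\<forall>z. poly p z = 0 \<longrightarrow> poly q z \<noteq> 0)"
proof (intro iffI coprimeI)
  fix c assume no_root: "\<forall>z. poly p z = 0 \<longrightarrow> poly q z \<noteq> 0" and c: "c dvd p" "c dvd q"
  have "degree c = 0"
  proof (rule ccontr)
    assume "degree c \<noteq> 0"
    then obtain z where "poly c z = 0" using alg_closed_imp_poly_has_root[of c] by auto
    then have "poly p z = 0" "poly q z = 0" using c by (auto elim!: dvdE)
    then show False using no_root by blast
  qed
  then show "is_unit c" using assms c by (auto simp: is_unit_iff_degree)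
qed (use coprime_poly_0 in blast)

text \<open>Points of \<open>S\<close> that are not roots have order 0, so several polynomials can
  be factored over one index set.\<close>

lemma splits_over_roots:
  fixes p :: "'b :: alg_closed_field poly"
  assumes "p \<noteq> 0" "finite S" "{c. poly p c = 0} \<subseteq> S"
  shows "p = smult (lead_coeff p) (\<Prod>c\<in>S. [:- c, 1:] ^ order c p)"
proof -
  obtain A where A: "size A = degree p" "p = smult (lead_coeff p) (\<Prod>x\<in>#A. [:- x, 1:])"
    using alg_closed_imp_factorization[OF assms(1)] by blast
  have "proots p = proots (\<Prod>x\<in>#A. [:- x, 1:])"
    using A(2) assms(1) by (metis leading_coeff_0_iff proots_smult)
  also have "\<dots> = (\<Sum>x\<in>#A. proots [:- x, 1:])"
    by (subst proots_prod_mset [where A = "image_mset (\<lambda>x. [:- x, 1:]) A", simplified])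
      (auto simp: image_mset.compositionality o_def)
  also have "\<dots> = A" by simp
  finally have "proots p = A" .
  then have "(\<Prod>x\<in>#A. [:- x, 1:]) = (\<Prod>c\<in>{c. poly p c = 0}. [:- c, 1:] ^ order c p)"
    using assms(1) by (subst image_prod_mset_multiplicity) (auto intro!: prod.cong)
  also have "\<dots> = (\<Prod>c\<in>S. [:- c, 1:] ^ order c p)"
    using assms by (intro prod.mono_neutral_left) (auto simp: order_root)
  finally show ?thesis using A(2) by simp
qed

text \<open>With \<open>u\<close> the cofactor of \<open>(z - c)^(order c p)\<close> in
  \<open>p\<close>, dividing the Wronskian by one power less leaves the value
  \<open>- order c p * q(c) * u(c)\<close> at \<open>c\<close>. The restriction on the
  characteristic serves to make this nonzero.\<close>

lemma order_wronskian:
  fixes p q :: "'b :: field poly"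
  assumes "p \<noteq> 0" "poly p c = 0" "poly q c \<noteq> 0" "(of_nat (order c p) :: 'b) \<noteq> 0"
  shows "order c p = Suc (order c (wronskian q p))"
proof -
  obtain e where e: "order c p = Suc e"
    using assms order_root[of p c] by (cases "order c p") auto
  obtain u where u: "p = [:- c, 1:] ^ Suc e * u" "\<not> [:- c, 1:] dvd u"
    using order_decomp[OF assms(1), of c] e by auto
  have uc: "poly u c \<noteq> 0" using u(2) by (simp add: poly_eq_0_iff_dvd)
  define t where "t = [:- c, 1:] * (pderiv q * u - q * pderiv u) - smult (of_nat (Suc e)) (q * u)"
  have t: "wronskian q p = [:- c, 1:] ^ e * t"
    unfolding wronskian_def u(1) t_def pderiv_mult pderiv_power_Suc by (simp add: pderiv_pCons algebra_simps)
  have "poly t c \<noteq> 0" using assms uc e by (simp add: t_def)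
  then have "t \<noteq> 0" "order c t = 0" by (auto simp: order_root)
  then have "order c (wronskian q p) = e"
    unfolding t by (subst order_mult) (auto simp: order_power_n_n)
  then show ?thesis using e by simp
qed

lemma wronskian_commute: "wronskian q p = - wronskian p q"
  by (simp add: wronskian_def)

section \<open>Gauss norms\<close>

context nonarch_absolute_value
begin

section \<open>Arithmetic of a non-archimedean absolute value\<close>

lemma zero [simp]: "v 0 = 0"
  by (simp add: eq_0_iff)

lemma pos_iff: "v x > 0 \<longleftrightarrow> x \<noteq> 0"
  using nonneg[of x] eq_0_iff[of x] by linarith

lemma power: "v (x ^ n) = v x ^ n"
  by (induction n) (auto simp: one mult)

lemma prod: "v (prod f S) = (\<Prod>i\<in>S. v (f i))"
  by (induction S rule: infinite_finite_induct) (auto simp: one mult)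

lemma inverse: "v (inverse x) = inverse (v x)"
  by (cases "x = 0") (auto simp: field_simps eq_0_iff one simp flip: mult)

lemma divide: "v (x / y) = v x / v y"
  by (simp add: divide_inverse mult inverse)

lemma diff_commute: "v (x - y) = v (y - x)"
  using minus[of "x - y"] by simp

lemma diff_le: "v (x - y) \<le> max (v x) (v y)"
  using ultrametric[of x "- y"] by (simp add: minus)

lemma add_eq_left: "v y < v x \<Longrightarrow> v (x + y) = v x"
  using ultrametric[of x y] diff_le[of "x + y" y] by auto

lemma sum_le:
  assumes "\<And>i. i \<in> S \<Longrightarrow> v (f i) \<le> B" "0 \<le> B"
  shows "v (sum f S) \<le> B"
  using assms(1)
proof (induction S rule: infinite_finite_induct)
  case (insert x F)
  then have "max (v (f x)) (v (sum f F)) \<le> B" by simp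
  with ultrametric have "v (f x + sum f F) \<le> B" by (rule order.trans)
  then show ?case using insert.hyps by simp
qed (use assms(2) in auto)

lemma sum_less:
  assumes "\<And>i. i \<in> S \<Longrightarrow> v (f i) < B" "0 < B"
  shows "v (sum f S) < B"
  using assms(1)
proof (induction S rule: infinite_finite_induct)
  case (insert x F)
  then have "max (v (f x)) (v (sum f F)) < B" by simp
  with ultrametric have "v (f x + sum f F) < B" by (rule le_less_trans)
  then show ?case using insert.hyps by simp
qed (use assms(2) in auto)

lemma max_dist_cong:
  assumes "v (x - y) \<le> r"
  shows "max r (v (x - c)) = max r (v (y - c))"
  using ultrametric[of "x - y" "y - c"] ultrametric[of "y - x" "x - c"] assms
    diff_commute[of x y] by auto

section \<open>Gauss norms about 0 and dominant coefficients\<close>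

definition gauss :: "real \<Rightarrow> 'a poly \<Rightarrow> real" where
  "gauss r p = Max ((\<lambda>i. v (coeff p i) * r ^ i) ` {..degree p})"

text \<open>The last index attaining the norm is the Weierstrass degree. For a nonzero split
  polynomial it counts the roots in the closed disc of radius \<open>r\<close> about 0.\<close>

definition dominant :: "real \<Rightarrow> 'a poly \<Rightarrow> nat \<Rightarrow> bool" where
  "dominant r p i \<longleftrightarrow> v (coeff p i) * r ^ i = gauss r p \<and> (\<forall>j>i. v (coeff p j) * r ^ j < gauss r p)"

lemma gauss_in: "\<exists>i\<le>degree p. gauss r p = v (coeff p i) * r ^ i"
proof -
  have "gauss r p \<in> (\<lambda>i. v (coeff p i) * r ^ i) ` {..degree p}"
    unfolding gauss_def by (intro Max_in) auto
  then show ?thesis by auto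
qed

lemma gauss_0 [simp]: "gauss r 0 = 0"
  by (simp add: gauss_def)

lemma gauss_le: "(\<And>i. v (coeff p i) * r ^ i \<le> B) \<Longrightarrow> gauss r p \<le> B"
  using gauss_in[of p r] by auto

lemma gauss_less: "(\<And>i. v (coeff p i) * r ^ i < B) \<Longrightarrow> gauss r p < B"
  using gauss_in[of p r] by auto

context
  fixes r :: real
  assumes r: "r > 0"
begin

lemma gauss_nonneg: "gauss r p \<ge> 0"
  using gauss_in[of p r] r by (auto simp: nonneg)

lemma gauss_ge: "v (coeff p i) * r ^ i \<le> gauss r p"
proof (cases "i \<le> degree p")
  case True
  then show ?thesis unfolding gauss_def by (intro Max_ge) auto
next
  case False
  then show ?thesis using gauss_nonneg by (simp add: coeff_eq_0)
qed

lemma gauss_pos: "p \<noteq> 0 \<Longrightarrow> gauss r p > 0"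
  using gauss_ge[of p "degree p"] r
  by (smt (verit) leading_coeff_0_iff mult_pos_pos pos_iff zero_less_power)

lemma gauss_add: "gauss r (p + q) \<le> max (gauss r p) (gauss r q)"
proof (rule gauss_le)
  fix i
  have "v (coeff p i + coeff q i) * r ^ i \<le> max (v (coeff p i)) (v (coeff q i)) * r ^ i"
    using r by (intro mult_right_mono ultrametric) auto
  also have "\<dots> \<le> max (gauss r p) (gauss r q)"
    using gauss_ge[of p i] gauss_ge[of q i] by (auto simp: max_def)
  finally show "v (coeff (p + q) i) * r ^ i \<le> max (gauss r p) (gauss r q)" by simp
qed

lemma gauss_minus: "gauss r (- p) = gauss r p"
  by (simp add: gauss_def minus)

lemma gauss_add_eq_left: "gauss r q < gauss r p \<Longrightarrow> gauss r (p + q) = gauss r p"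
  using gauss_add[of p q] gauss_add[of "p + q" "- q"] by (auto simp: gauss_minus)

lemma gauss_const [simp]: "gauss r [:c:] = v c"
  by (simp add: gauss_def)

lemma dominant_exists:
  assumes "p \<noteq> 0"
  shows "\<exists>i. dominant r p i"
proof -
  define I where "I = {i. i \<le> degree p \<and> v (coeff p i) * r ^ i = gauss r p}"
  have I: "finite I" "I \<noteq> {}"
    using gauss_in[of p r] by (auto simp: I_def)
  have "v (coeff p j) * r ^ j < gauss r p" if "j > Max I" for j
  proof -
    from that have "j \<notin> I" using I by (meson Max_ge leD)
    then have "v (coeff p j) * r ^ j \<noteq> gauss r p"
      using gauss_pos[OF assms] by (cases "j \<le> degree p") (auto simp: I_def coeff_eq_0)
    then show ?thesis using gauss_ge[of p j] by linarith
  qed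
  moreover have "Max I \<in> I" using I by (rule Max_in)
  ultimately show ?thesis unfolding dominant_def I_def by blast
qed

text \<open>In the coefficient of index \<open>i + j\<close>, every product except that of the two
  dominant coefficients uses an index beyond \<open>i\<close> or beyond \<open>j\<close>, so it is
  strictly smaller. Beyond \<open>i + j\<close> all products are.\<close>

lemma coeff_mult_dominant:
  assumes "dominant r p i" "dominant r q j" "p \<noteq> 0" "q \<noteq> 0"
  shows "v (coeff (p * q) (i + j)) * r ^ (i + j) = gauss r p * gauss r q"
    and "k > i + j \<Longrightarrow> v (coeff (p * q) k) * r ^ k < gauss r p * gauss r q"
proof -
  let ?G = "gauss r p * gauss r q"
  have G: "gauss r p > 0" "gauss r q > 0" using assms by (auto intro: gauss_pos)
  have small: "v (coeff p a * coeff q b) * r ^ (a + b) < ?G" if "a > i \<or> b > j" for a b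
  proof -
    have "v (coeff p a * coeff q b) * r ^ (a + b) = (v (coeff p a) * r ^ a) * (v (coeff q b) * r ^ b)"
      by (simp add: mult power_add algebra_simps)
    also have "\<dots> < ?G"
    proof (cases "a > i")
      case True
      then have "v (coeff p a) * r ^ a < gauss r p" using assms by (auto simp: dominant_def)
      then show ?thesis using gauss_ge[of q b] G r
        by (intro le_less_trans[OF mult_left_mono mult_strict_right_mono]) (auto simp: nonneg)
    next
      case False
      then have "v (coeff q b) * r ^ b < gauss r q" using assms that by (auto simp: dominant_def)
      then show ?thesis using gauss_ge[of p a] G r
        by (intro le_less_trans[OF mult_right_mono mult_strict_left_mono]) (auto simp: nonneg)
    qed
    finally show ?thesis .
  qed
  have sumsmall: "v (\<Sum>a\<in>A. coeff p a * coeff q (k - a)) * r ^ k < ?G"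
    if "\<And>a. a \<in> A \<Longrightarrow> a \<le> k \<and> (a > i \<or> k - a > j)" for A k
  proof -
    have "v (\<Sum>a\<in>A. coeff p a * coeff q (k - a)) < ?G / r ^ k"
    proof (rule sum_less)
      fix a assume "a \<in> A"
      then show "v (coeff p a * coeff q (k - a)) < ?G / r ^ k"
        using small[of a "k - a"] that[of a] r by (simp add: field_simps)
    qed (use G r in auto)
    then show ?thesis using r by (simp add: field_simps)
  qed
  show "v (coeff (p * q) k) * r ^ k < ?G" if "k > i + j"
    unfolding coeff_mult by (rule sumsmall) (use that in auto)
  have *: "coeff (p * q) (i + j)
      = coeff p i * coeff q j + (\<Sum>a\<in>{..i + j} - {i}. coeff p a * coeff q (i + j - a))"
    unfolding coeff_mult by (subst sum.remove[of _ i]) auto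
  have "?G = (v (coeff p i) * r ^ i) * (v (coeff q j) * r ^ j)"
    using assms by (simp add: dominant_def)
  then have eq: "?G = v (coeff p i * coeff q j) * r ^ (i + j)"
    by (simp add: mult power_add)
  have "v (\<Sum>a\<in>{..i + j} - {i}. coeff p a * coeff q (i + j - a)) * r ^ (i + j) < ?G"
    by (rule sumsmall) auto
  also note eq
  finally have "v (coeff (p * q) (i + j)) = v (coeff p i * coeff q j)"
    unfolding * by (intro add_eq_left) (use r in simp)
  then show "v (coeff (p * q) (i + j)) * r ^ (i + j) = ?G"
    using eq by simp
qed

text \<open>Gauss's lemma: the dominant coefficients give the lower bound, the ultrametric
  inequality the upper one.\<close>

lemma gauss_mult: "gauss r (p * q) = gauss r p * gauss r q"
proof (cases "p = 0 \<or> q = 0")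
  case False
  then obtain i j where ij: "dominant r p i" "dominant r q j" using dominant_exists by blast
  have "gauss r (p * q) \<ge> gauss r p * gauss r q"
    using coeff_mult_dominant(1)[OF ij] gauss_ge[of "p * q" "i + j"] False by auto
  moreover have "gauss r (p * q) \<le> gauss r p * gauss r q"
  proof (rule gauss_le)
    fix k
    have "v (coeff (p * q) k) \<le> gauss r p * gauss r q / r ^ k" unfolding coeff_mult
    proof (rule sum_le)
      fix a assume "a \<in> {..k}"
      then have "v (coeff p a * coeff q (k - a)) * r ^ k
          = (v (coeff p a) * r ^ a) * (v (coeff q (k - a)) * r ^ (k - a))"
        by (simp add: mult algebra_simps flip: power_add)
      also have "\<dots> \<le> gauss r p * gauss r q"
        using r by (intro mult_mono gauss_ge gauss_nonneg) (auto simp: nonneg)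
      finally show "v (coeff p a * coeff q (k - a)) \<le> gauss r p * gauss r q / r ^ k"
        using r by (simp add: field_simps)
    qed (use r gauss_nonneg in auto)
    then show "v (coeff (p * q) k) * r ^ k \<le> gauss r p * gauss r q" using r by (simp add: field_simps)
  qed
  ultimately show ?thesis by simp
qed auto

lemma gauss_power: "gauss r (p ^ n) = gauss r p ^ n"
  by (induction n) (auto simp: gauss_mult one pCons_one[symmetric] simp del: pCons_one)

lemma gauss_prod: "gauss r (prod f S) = (\<Prod>i\<in>S. gauss r (f i))"
  by (induction S rule: infinite_finite_induct)
    (auto simp: gauss_mult one pCons_one[symmetric] simp del: pCons_one)

lemma gauss_smult: "gauss r (smult c p) = v c * gauss r p"
  using gauss_mult[of "[:c:]" p] by simp

lemma gauss_linear: "gauss r [:- c, 1:] = max r (v c)"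
proof -
  have "{..1::nat} = {0, 1}" by auto
  then show ?thesis by (simp add: gauss_def minus one max.commute)
qed

lemma dominant_mult:
  assumes "dominant r p i" "dominant r q j" "p \<noteq> 0" "q \<noteq> 0"
  shows "dominant r (p * q) (i + j)"
  using coeff_mult_dominant[OF assms] by (simp add: dominant_def gauss_mult)

lemma dominant_1: "dominant r 1 0"
  by (simp add: dominant_def one pCons_one[symmetric] coeff_pCons del: pCons_one split: nat.split)

lemma dominant_prod_power:
  assumes "finite S" "\<And>c. c \<in> S \<Longrightarrow> dominant r (f c) i \<and> f c \<noteq> 0"
  shows "dominant r (\<Prod>c\<in>S. f c ^ m c) (i * sum m S)"
  using assms
proof (induction S rule: finite_induct)
  case empty
  then show ?case by (simp add: dominant_1)
next
  case (insert x F)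
  then have "dominant r (f x)  i" "f x \<noteq> 0" by auto
  then have "dominant r (f x ^ n) (i * n)" for n
    by (induction n) (auto simp: dominant_1 intro: dominant_mult)
  then have "dominant r (f x ^ m x * (\<Prod>c\<in>F. f c ^ m c)) (i * m x + i * sum m F)"
    using insert by (intro dominant_mult) auto
  then show ?case using insert.hyps by (simp add: algebra_simps)
qed

lemma dominant_linear_small: "v c \<le> r \<Longrightarrow> dominant r [:- c, 1:] 1"
  using r by (auto simp: dominant_def gauss_linear one coeff_eq_0)

lemma dominant_linear_large: "v c > r \<Longrightarrow> dominant r [:- c, 1:] 0"
  using r by (auto simp: dominant_def gauss_linear one minus coeff_pCons split: nat.split)

text \<open>The dominant coefficient of \<open>N * C\<close> sits in degree at least
  \<open>degree N\<close>, where \<open>B\<close> has no coefficients to cancel it.\<close>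

lemma gauss_reduced_bound:
  assumes N: "dominant r N (degree N)" "N \<noteq> 0" and B: "\<And>i. i \<ge> degree N \<Longrightarrow> coeff B i = 0"
  shows "gauss r N * gauss r C \<le> gauss r (N * C + B)"
proof (cases "C = 0")
  case True
  then show ?thesis using gauss_nonneg by simp
next
  case False
  then obtain j where j: "dominant r C j" using dominant_exists by blast
  have "coeff (N * C + B) (degree N + j) = coeff (N * C) (degree N + j)" using B by simp
  then show ?thesis
    using coeff_mult_dominant(1)[OF N(1) j N(2) False] gauss_ge[of "N * C + B" "degree N + j"] by simp
qed

text \<open>Let \<open>Q1, P1\<close> collect the roots of two polynomials inside a closed disc and \<open>Q2, P2\<close> those outside.
  On the residue level, \<open>z\<close> times the logarithmic derivative of \<open>Q1 Q2 / (P1 P2)\<close> is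
  a principal part plus a regular part, and the constant \<open>k\<close> cannot be cancelled by either.\<close>
lemma gauss_wronskian_split:
  fixes Q1 Q2 P1 P2 :: "'a poly"
  assumes monic: "lead_coeff Q1 = 1" "lead_coeff P1 = 1"
    and inside: "dominant r Q1 (degree Q1)" "dominant r P1 (degree P1)"
    and outside: "dominant r Q2 0" "dominant r P2 0" "Q2 \<noteq> 0" "P2 \<noteq> 0"
    and Q: "Q = Q1 * Q2" and P: "P = P1 * P2"
  shows "v (of_nat (degree Q1) - of_nat (degree P1)) * gauss r Q * gauss r P
    \<le> r * gauss r (wronskian Q P)"
proof -
  define k :: 'a where "k = of_nat (degree Q1) - of_nat (degree P1)"
  let ?X = "[:0, 1:] :: 'a poly"
  define N M where "N = Q1 * P1" and "M = Q2 * P2"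
  define W1 W2 where "W1 = wronskian Q1 P1" and "W2 = wronskian Q2 P2"
  \<comment> \<open>Subtracting \<open>k N\<close> removes the top coefficient of
    \<open>z W1\<close>, so that \<open>B / N\<close> is a pure principal part.\<close>
  define B where "B = ?X * W1 - smult k N"
  \<comment> \<open>Since \<open>M\<close> has no roots in the disc, its constant term
    \<open>m\<close> dominates, and \<open>M'\<close> is a strictly smaller perturbation.\<close>
  define m where "m = coeff M 0"
  define M' where "M' = M - [:m:]"
  define C where "C = [:k * m:] + ?X * W2"
  have nz: "Q1 \<noteq> 0" "P1 \<noteq> 0" "N \<noteq> 0" "M \<noteq> 0" using monic outside by (auto simp: N_def M_def)
  have degN: "degree N = degree Q1 + degree P1" unfolding N_def using nz by (simp add: degree_mult_eq)
  have dN: "dominant r N (degree N)" unfolding degN using inside nz by (simp add: N_def dominant_mult)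
  have dM: "dominant r M 0" unfolding M_def using dominant_mult[OF outside] by simp
  have gM: "gauss r M = v m" using dM by (simp add: dominant_def m_def)
  have gM': "gauss r M' < v m"
  proof (rule gauss_less)
    fix i show "v (coeff M' i) * r ^ i < v m"
      using dM gM gauss_pos[OF nz(4)] by (cases "i = 0") (auto simp: M'_def m_def dominant_def coeff_pCons split: nat.split)
  qed
  have "coeff B i = 0" if "i \<ge> degree N" for i
  proof (cases "i = degree N")
    case True
    have "coeff (?X * W1) (degree N) = k"
      unfolding W1_def degN coeff_x_mult_wronskian(1)[OF order_refl order_refl] k_def using monic by simp
    moreover have "coeff N (degree N) = 1" using monic unfolding N_def by (simp add: lead_coeff_mult)
    ultimately show ?thesis unfolding True B_def by (simp del: mult_pCons_left)
  next
    case False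
    have "degree (?X * W1) \<le> degree N"
      unfolding W1_def degN by (rule coeff_x_mult_wronskian) auto
    then show ?thesis using False that by (simp add: B_def coeff_eq_0)
  qed
  then have B: "coeff (smult m B) i = 0" if "i \<ge> degree N" for i using that by simp
  define G where "G = gauss r (N * C + smult m B)"
  have G1: "gauss r N * gauss r C \<le> G"
    unfolding G_def by (rule gauss_reduced_bound[OF dN nz(3) B])
  have "v (k * m) \<le> gauss r C" using gauss_ge[of C 0] by (simp add: C_def)
  then have G2: "gauss r N * (v k * v m) \<le> G"
    using G1 gauss_nonneg[of N] by (smt (verit) mult mult_left_mono)
  have "gauss r (smult m B) \<le> max G (gauss r (N * C))"
    using gauss_add[of "N * C + smult m B" "- (N * C)"] by (simp add: gauss_minus G_def)
  then have G3: "v m * gauss r B \<le> G" using G1 by (simp add: gauss_mult gauss_smult)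
  \<comment> \<open>The first summand has norm \<open>G\<close>. The second carries the factor
    \<open>M'\<close>, so by \<open>G2\<close> and \<open>G3\<close> it is strictly smaller, apart
    from the case in which the maximum in \<open>main\<close> vanishes.\<close>
  have eq: "?X * wronskian Q P = (N * C + smult m B) + M' * (smult k N + B)"
  proof -
    have "?X * wronskian Q P = (?X * W1) * M + ?X * W2 * N"
      unfolding Q P by (simp add: wronskian_def pderiv_mult M_def N_def W1_def W2_def algebra_simps)
    also have "?X * W1 = smult k N + B" by (simp add: B_def)
    also have "M = M' + [:m:]" by (simp add: M'_def)
    finally show ?thesis by (simp add: C_def algebra_simps)
  qed
  have m: "v m > 0" using gM gauss_pos[OF nz(4)] by simp
  have main: "gauss r N * (v k * v m) \<le> gauss r (?X * wronskian Q P)"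
  proof (cases "max (v k * gauss r N) (gauss r B) > 0")
    case True
    have "gauss r (M' * (smult k N + B)) \<le> gauss r M' * max (v k * gauss r N) (gauss r B)"
      using gauss_add[of "smult k N" B] gauss_nonneg[of M'] by (auto simp: gauss_mult gauss_smult intro: mult_left_mono)
    also have "\<dots> < v m * max (v k * gauss r N) (gauss r B)"
      using True gM' by (intro mult_strict_right_mono)
    also have "\<dots> \<le> G" using G2 G3 by (auto simp: max_def algebra_simps)
    finally have "gauss r (?X * wronskian Q P) = G"
      unfolding eq G_def by (rule gauss_add_eq_left)
    then show ?thesis using G2 by simp
  next
    case False
    then have "v k * gauss r N = 0"
      using mult_nonneg_nonneg[OF nonneg[of k] gauss_nonneg[of N]] by linarith
    then have "gauss r N * (v k * v m) \<le> 0" by auto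
    also have "\<dots> \<le> gauss r (?X * wronskian Q P)" by (rule gauss_nonneg)
    finally show ?thesis .
  qed
  have "gauss r ?X = r" using gauss_linear[of 0] r by simp
  moreover have "gauss r Q * gauss r P = gauss r N * v m"
    unfolding gM[symmetric] by (simp add: Q P N_def M_def gauss_mult)
  ultimately show ?thesis using main unfolding k_def[symmetric] gauss_mult by (simp add: algebra_simps)
qed

end

end

section \<open>Gauss norms on discs with arbitrary centre\<close>

locale alg_closed_nonarch = nonarch_absolute_value v for v :: "'a :: alg_closed_field \<Rightarrow> real"
begin

text \<open>The seminorm of the Berkovich point attached to the closed disc of centre
  \<open>x\<close> and radius \<open>r\<close>.\<close>

definition disc_norm :: "'a \<Rightarrow> real \<Rightarrow> 'a poly \<Rightarrow> real" where
  "disc_norm x r p = gauss r (pcompose p [:x, 1:])"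

lemma disc_norm_pos: "r > 0 \<Longrightarrow> p \<noteq> 0 \<Longrightarrow> disc_norm x r p > 0"
  unfolding disc_norm_def by (rule gauss_pos) (auto simp: pcompose_eq_0_iff)

lemma disc_norm_mult: "r > 0 \<Longrightarrow> disc_norm x r (p * q) = disc_norm x r p * disc_norm x r q"
  by (simp add: disc_norm_def pcompose_mult gauss_mult)

lemma disc_norm_mono:
  assumes "0 < s" "s \<le> r"
  shows "disc_norm x s p \<le> disc_norm x r p"
  unfolding disc_norm_def
proof (rule gauss_le)
  fix i let ?p = "pcompose p [:x, 1:]"
  have "v (coeff ?p i) * s ^ i \<le> v (coeff ?p i) * r ^ i"
    using assms by (intro mult_left_mono power_mono) (auto simp: nonneg)
  then show "v (coeff ?p i) * s ^ i \<le> gauss r ?p"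
    using gauss_ge[of r ?p i] assms by linarith
qed

text \<open>Apply the factor \<open>(s / r)^i\<close> to the index \<open>i\<close> that attains the
  norm at radius \<open>r\<close>; this \<open>i\<close> is at most the degree.\<close>

lemma disc_norm_shrink:
  assumes "0 < s" "s \<le> r"
  shows "disc_norm x r p * (s / r) ^ degree p \<le> disc_norm x s p"
proof -
  let ?p = "pcompose p [:x, 1:]"
  obtain i where i: "i \<le> degree ?p" "gauss r ?p = v (coeff ?p i) * r ^ i" using gauss_in by blast
  have "gauss r ?p * (s / r) ^ degree p \<le> gauss r ?p * (s / r) ^ i"
    using assms i gauss_nonneg[of r ?p] by (intro mult_left_mono power_decreasing) (auto simp: degree_pcompose)
  also have "\<dots> = v (coeff ?p i) * s ^ i" using assms i by (simp add: power_divide)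
  also have "\<dots> \<le> gauss s ?p" using assms gauss_ge by simp
  finally show ?thesis by (simp add: disc_norm_def)
qed

lemma pcompose_splits:
  fixes p :: "'a poly"
  assumes "p \<noteq> 0" "finite S" "{c. poly p c = 0} \<subseteq> S"
  shows "pcompose p [:x, 1:] = smult (lead_coeff p) (\<Prod>c\<in>S. [:- (c - x), 1:] ^ order c p)"
proof -
  have lin: "pcompose [:- c, 1:] [:x, 1:] = [:- (c - x), 1:]" for c :: 'a by (simp add: pcompose_pCons)
  have pow: "pcompose (q ^ n) [:x, 1:] = pcompose q [:x, 1:] ^ n" for q :: "'a poly" and n
    by (induction n) (auto simp: pcompose_mult pcompose_1)
  have "pcompose p [:x, 1:]
      = pcompose (smult (lead_coeff p) (\<Prod>c\<in>S. [:- c, 1:] ^ order c p)) [:x, 1:]"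
    using splits_over_roots[OF assms] by simp
  also have "\<dots> = smult (lead_coeff p) (\<Prod>c\<in>S. [:- (c - x), 1:] ^ order c p)"
    unfolding pcompose_smult pcompose_prod pow lin ..
  finally show ?thesis .
qed

text \<open>By multiplicativity it suffices to know the norm of a linear factor, which is
  \<open>max r (v (x - c))\<close>.\<close>

lemma disc_norm_roots:
  assumes "r > 0" "p \<noteq> 0" "finite S" "{c. poly p c = 0} \<subseteq> S"
  shows "disc_norm x r p = v (lead_coeff p) * (\<Prod>c\<in>S. max r (v (x - c)) ^ order c p)"
proof -
  have "gauss r ([:- (c - x), 1:] ^ order c p) = max r (v (x - c)) ^ order c p" for c
    unfolding gauss_power[OF assms(1)] gauss_linear[OF assms(1)] by (simp add: diff_commute)
  then show ?thesis
    unfolding disc_norm_def pcompose_splits[OF assms(2-4)] gauss_smult[OF assms(1)] gauss_prod[OF assms(1)]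
    by simp
qed

text \<open>Every point of a non-archimedean disc is a centre of it; in the root formula no factor
  changes.\<close>

lemma disc_norm_center:
  assumes "r > 0" "v (x - y) \<le> r"
  shows "disc_norm x r p = disc_norm y r p"
proof (cases "p = 0")
  case False
  then have "finite {c. poly p c = 0}" by (rule poly_roots_finite)
  then show ?thesis using disc_norm_roots[OF assms(1) False _ order_refl] max_dist_cong[OF assms(2)] by simp
qed (simp add: disc_norm_def)

text \<open>In passing from \<open>s\<close> to \<open>r\<close> across an annulus without roots,
  each root inside contributes a factor \<open>r / s\<close> and each root outside contributes
  1.\<close>

lemma disc_norm_scale:
  assumes "0 < s" "s \<le> r" "p \<noteq> 0" "finite S" "{c. poly p c = 0} \<subseteq> S"
    and gap: "\<And>c. c \<in> S \<Longrightarrow> v (y - c) \<le> s \<or> r \<le> v (y - c)"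
  shows "disc_norm y r p = disc_norm y s p * (r / s) ^ (\<Sum>c | c \<in> S \<and> v (y - c) \<le> s. order c p)"
proof -
  let ?A = "{c \<in> S. v (y - c) \<le> s}" and ?B = "{c \<in> S. \<not> v (y - c) \<le> s}"
  have split: "prod f S = prod f ?A * prod f ?B" for f :: "'a \<Rightarrow> real"
    by (subst prod.union_disjoint[symmetric]) (use assms in \<open>auto intro: prod.cong\<close>)
  have A: "(\<Prod>c\<in>?A. max r (v (y - c)) ^ order c p)
      = (\<Prod>c\<in>?A. max s (v (y - c)) ^ order c p) * (r / s) ^ sum (\<lambda>c. order c p) ?A"
    unfolding power_sum prod.distrib[symmetric]
    using assms by (intro prod.cong refl) (auto simp: max_def power_divide)
  have B: "(\<Prod>c\<in>?B. max r (v (y - c)) ^ order c p) = (\<Prod>c\<in>?B. max s (v (y - c)) ^ order c p)"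
    using assms by (intro prod.cong refl) (auto simp: max_def)
  have "r > 0" using assms by simp
  then show ?thesis
    unfolding disc_norm_roots[OF \<open>r > 0\<close> assms(3-5)] disc_norm_roots[OF assms(1,3-5)] split A B
    by (simp only: mult_ac)
qed

text \<open>With no root in the open disc, each factor \<open>max r (v (y - c))\<close> is just
  \<open>v (y - c)\<close>.\<close>

lemma disc_norm_point:
  assumes "r > 0" "p \<noteq> 0" "\<And>c. poly p c = 0 \<Longrightarrow> r \<le> v (y - c)"
  shows "disc_norm y r p = v (poly p y)"
proof -
  let ?S = "{c. poly p c = 0}"
  have S: "finite ?S" using assms by (simp add: poly_roots_finite)
  have "disc_norm y r p = v (lead_coeff p) * (\<Prod>c\<in>?S. v (y - c) ^ order c p)"
    unfolding disc_norm_roots[OF assms(1,2) S order_refl]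
    using assms(3) by (auto simp: max_def intro!: arg_cong2[where f = times] prod.cong)
  also have "\<dots> = v (poly (smult (lead_coeff p) (\<Prod>c\<in>?S. [:- c, 1:] ^ order c p)) y)"
    by (simp add: mult prod power poly_prod)
  also have "\<dots> = v (poly p y)" using splits_over_roots[OF assms(2) S order_refl] by simp
  finally show ?thesis .
qed

lemma degree_eq_sum_order:
  fixes p :: "'a poly"
  assumes "p \<noteq> 0" "finite S" "{c. poly p c = 0} \<subseteq> S"
  shows "degree p = (\<Sum>c\<in>S. order c p)"
proof -
  have "degree p = degree (\<Prod>c\<in>S. [:- c, 1:] ^ order c p)"
    using splits_over_roots[OF assms] assms(1) by (metis degree_smult_eq leading_coeff_0_iff)
  also have "\<dots> = (\<Sum>c\<in>S. degree ([:- c, 1:] ^ order c p))"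
    by (rule degree_prod_eq_sum_degree) auto
  finally show ?thesis by (simp add: degree_power_eq)
qed

text \<open>After moving \<open>x\<close> to 0, the roots in the disc go into the monic factors
  \<open>I\<close>, the other roots and the leading coefficients into \<open>E\<close>, and
  \<open>gauss_wronskian_split\<close> applies.\<close>

lemma disc_norm_wronskian:
  assumes r: "r > 0" and nz: "P \<noteq> 0" "Q \<noteq> 0" and S: "finite S"
    "{c. poly P c = 0} \<subseteq> S" "{c. poly Q c = 0} \<subseteq> S"
  shows "v (of_nat (\<Sum>c | c \<in> S \<and> v (x - c) \<le> r. order c Q)
        - of_nat (\<Sum>c | c \<in> S \<and> v (x - c) \<le> r. order c P)) * disc_norm x r (P * Q)
    \<le> r * disc_norm x r (wronskian Q P)"
proof -
  let ?L = "\<lambda>c. [:- (c - x), 1:]"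
  define I where "I p = (\<Prod>c | c \<in> S \<and> v (x - c) \<le> r. ?L c ^ order c p)" for p :: "'a poly"
  define E where "E p = smult (lead_coeff p) (\<Prod>c | c \<in> S \<and> \<not> v (x - c) \<le> r. ?L c ^ order c p)"
    for p :: "'a poly"
  have split: "pcompose p [:x, 1:] = I p * E p" if "p \<noteq> 0" "{c. poly p c = 0} \<subseteq> S" for p
  proof -
    have "(\<Prod>c\<in>S. ?L c ^ order c p) = (\<Prod>c | c \<in> S \<and> v (x - c) \<le> r. ?L c ^ order c p)
        * (\<Prod>c | c \<in> S \<and> \<not> v (x - c) \<le> r. ?L c ^ order c p)"
      by (subst prod.union_disjoint[symmetric]) (use S in \<open>auto intro: prod.cong\<close>)
    then show ?thesis using that S by (simp add: pcompose_splits[where S = S] I_def E_def)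
  qed
  have monic: "lead_coeff (I p) = 1" for p
    unfolding I_def lead_coeff_prod lead_coeff_power by simp
  have deg: "degree (I p) = (\<Sum>c | c \<in> S \<and> v (x - c) \<le> r. order c p)" for p
    unfolding I_def by (subst degree_prod_eq_sum_degree) (auto simp: degree_power_eq)
  have inside: "dominant r (I p) (degree (I p))" for p
  proof -
    have "dominant r (I p) (1 * degree (I p))"
      unfolding deg unfolding I_def using S
      by (intro dominant_prod_power[OF r] conjI dominant_linear_small[OF r]) (auto simp: diff_commute)
    then show ?thesis by simp
  qed
  have outside: "dominant r (E p) 0 \<and> E p \<noteq> 0" if "p \<noteq> 0" for p
  proof -
    let ?F = "\<Prod>c | c \<in> S \<and> \<not> v (x - c) \<le> r. ?L c ^ order c p"
    have "dominant r ?F (0 * (\<Sum>c | c \<in> S \<and> \<not> v (x - c) \<le> r. order c p))"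
      using S by (intro dominant_prod_power[OF r] conjI dominant_linear_large[OF r]) (auto simp: diff_commute)
    moreover have "dominant r [:lead_coeff p:] 0"
      using that r by (auto simp: dominant_def coeff_pCons pos_iff split: nat.split)
    moreover have "?F \<noteq> 0" using S by auto
    ultimately have "dominant r ([:lead_coeff p:] * ?F) (0 + 0)"
      using that by (intro dominant_mult[OF r]) auto
    then show ?thesis using that \<open>?F \<noteq> 0\<close> by (simp add: E_def)
  qed
  have w: "pcompose (wronskian Q P) [:x, 1:]
      = wronskian (pcompose Q [:x, 1:]) (pcompose P [:x, 1:])"
    by (simp add: wronskian_def pderiv_pcompose pcompose_mult pcompose_diff pderiv_pCons)
  show ?thesis
    using gauss_wronskian_split[OF r monic monic inside inside, of "E Q" "E P"
        "pcompose Q [:x, 1:]" Q "pcompose P [:x, 1:]" P] outside nz split S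
    unfolding disc_norm_def w deg pcompose_mult gauss_mult[OF r] by (simp only: mult_ac simp_thms)
qed

end

section \<open>Critical points near the basin of infinity\<close>

context alg_closed_nonarch
begin

text \<open>Pigeonhole: otherwise every fibre of \<open>g\<close> contributes at least 1 to the sum,
  as \<open>h\<close> is integer-valued.\<close>

lemma exists_class_nonpos:
  fixes h :: "'b \<Rightarrow> int"
  assumes "finite D" "sum h D < int (card (g ` D))"
  shows "\<exists>w\<in>D. (\<Sum>c | c \<in> D \<and> g c = g w. h c) \<le> 0"
proof (rule ccontr)
  assume "\<not> ?thesis"
  then have "1 \<le> (\<Sum>c | c \<in> D \<and> g c = b. h c)" if "b \<in> g ` D" for b using that by force
  then have "(\<Sum>b\<in>g ` D. 1) \<le> (\<Sum>b\<in>g ` D. \<Sum>c | c \<in> D \<and> g c = b. h c)" by (rule sum_mono)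
  then show False using assms sum.image_gen[OF assms(1), of h g] by simp
qed

lemma ball_eq_iff:
  assumes "s > 0"
  shows "{d. v (c - d) < s} = {d. v (w - d) < s} \<longleftrightarrow> v (w - c) < s"
proof
  assume "{d. v (c - d) < s} = {d. v (w - d) < s}"
  moreover have "c \<in> {d. v (c - d) < s}" using assms by simp
  ultimately show "v (w - c) < s" by blast
next
  assume "v (w - c) < s"
  then have "v (c - d) < s \<longleftrightarrow> v (w - d) < s" for d
    using ultrametric[of "w - c" "c - d"] diff_le[of "w - d" "w - c"] by auto
  then show "{d. v (c - d) < s} = {d. v (w - d) < s}" by simp
qed

definition inner_order :: "'a set \<Rightarrow> 'a \<Rightarrow> real \<Rightarrow> 'a poly \<Rightarrow> nat" where
  "inner_order S x s p = (\<Sum>c | c \<in> S \<and> v (x - c) \<le> s. order c p)"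

text \<open>Starting from a disc with at least as many zeros of \<open>W\<close> as of \<open>P Q\<close>, one can always move into
  a residue class with the same property, until \<open>\<bar>Q/P\<bar>\<close> has dropped to \<open>T\<close>. Along the way
  \<open>\<bar>W/(P Q)\<bar>\<close> does not increase.\<close>
lemma descent:
  fixes P Q W :: "'a poly" and T :: real
  defines "h \<equiv> \<lambda>c. int (order c (P * Q)) - int (order c W)"
  defines "S \<equiv> {c. poly (P * Q * W) c = 0}"
  assumes nz: "P \<noteq> 0" "Q \<noteq> 0" "W \<noteq> 0"
    and crit: "\<And>c. poly W c = 0 \<Longrightarrow> poly P c \<noteq> 0 \<Longrightarrow> v (poly Q c) \<le> T * v (poly P c)"
    and pos: "\<And>c. poly (P * Q) c = 0 \<Longrightarrow> h c > 0"
    and "r > 0" "{c \<in> S. v (x - c) < r} \<noteq> {}" "(\<Sum>c | c \<in> S \<and> v (x - c) < r. h c) \<le> 0"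
    and "T * disc_norm x r P < disc_norm x r Q"
  shows "\<exists>b s. 0 < s \<and> s \<le> r \<and> v (x - b) \<le> r \<and> disc_norm b s Q \<le> T * disc_norm b s P \<and>
    disc_norm b s W * disc_norm x r (P * Q) \<le> disc_norm x r W * disc_norm b s (P * Q) \<and>
    inner_order S b s P < inner_order S b s Q"
  using assms(8-11)
proof (induction "card {c \<in> S. v (x - c) < r}" arbitrary: x r rule: less_induct)
  case less
  note r = \<open>r > 0\<close>
  have S: "finite S" "{c. poly P c = 0} \<subseteq> S" "{c. poly Q c = 0} \<subseteq> S" "{c. poly W c = 0} \<subseteq> S"
    "{c. poly (P * Q) c = 0} \<subseteq> S"
    using nz by (auto simp: S_def poly_roots_finite)
  let ?D = "{c \<in> S. v (x - c) < r}"
  obtain y where y: "y \<in> S" "v (x - y) < r" using less.prems by auto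
  have center: "disc_norm x r p = disc_norm y r p" for p
    using y r by (intro disc_norm_center) auto
  have D: "c \<in> ?D \<longleftrightarrow> c \<in> S \<and> v (y - c) < r" for c
    using y diff_le[of "x - c" "x - y"] ultrametric[of "x - y" "y - c"] by (auto simp: diff_commute)
  \<comment> \<open>The radius of the smallest closed disc containing \<open>?D\<close>. No point of
    \<open>S\<close> has distance from \<open>y\<close> strictly between \<open>s0\<close> and
    \<open>r\<close>.\<close>
  define s0 where "s0 = Max ((\<lambda>c. v (y - c)) ` ?D)"
  have s0_ge: "v (y - c) \<le> s0" if "c \<in> ?D" for c
    unfolding s0_def using S that by (intro Max_ge) auto
  have "s0 \<in> (\<lambda>c. v (y - c)) ` ?D" unfolding s0_def using S y by (intro Max_in) auto
  then obtain z where z: "z \<in> ?D" "s0 = v (y - z)" by auto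
  have s0: "0 \<le> s0" "s0 < r" using z D nonneg by auto
  have inner: "{c. c \<in> S \<and> v (y - c) \<le> s} = ?D" if "s0 \<le> s" "s < r" for s
    using s0_ge D that by force
  have scale: "disc_norm y r p = disc_norm y s p * (r / s) ^ (\<Sum>c\<in>?D. order c p)"
    if "0 < s" "s0 \<le> s" "s < r" "p \<noteq> 0" "{c. poly p c = 0} \<subseteq> S" for s p
  proof -
    have "v (y - c) \<le> s \<or> r \<le> v (y - c)" if "c \<in> S" for c
      using s0_ge[of c] D[of c] that \<open>s0 \<le> s\<close> by force
    then show ?thesis
      using disc_norm_scale[of s r p S y] inner that S by simp
  qed
  have ord_le: "(\<Sum>c\<in>?D. order c (P * Q)) \<le> (\<Sum>c\<in>?D. order c W)"
    using less.prems(3) by (simp add: h_def sum_subtractf flip: of_nat_sum)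
  \<comment> \<open>In shrinking from \<open>r\<close> to \<open>s\<close>, the norm of
    \<open>W\<close> loses at least as many factors \<open>r / s\<close> as that of
    \<open>P * Q\<close>, by \<open>ord_le\<close>.\<close>
  have ratio: "disc_norm y s W * disc_norm y r (P * Q) \<le> disc_norm y r W * disc_norm y s (P * Q)"
    if "0 < s" "s0 \<le> s" "s < r" for s
  proof -
    have "(r / s) ^ (\<Sum>c\<in>?D. order c (P * Q)) \<le> (r / s) ^ (\<Sum>c\<in>?D. order c W)"
      using that ord_le by (intro power_increasing) auto
    then have "disc_norm y s W * disc_norm y s (P * Q) * (r / s) ^ (\<Sum>c\<in>?D. order c (P * Q))
        \<le> disc_norm y s W * disc_norm y s (P * Q) * (r / s) ^ (\<Sum>c\<in>?D. order c W)"
      using disc_norm_pos[OF that(1)] nz by (intro mult_left_mono) (auto intro: less_imp_le)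
    then show ?thesis
      using scale[OF that, of W] scale[OF that, of "P * Q"] nz S by (simp add: algebra_simps)
  qed
  show ?case
  proof (cases "\<exists>s. 0 < s \<and> s0 \<le> s \<and> s < r \<and> disc_norm y s Q \<le> T * disc_norm y s P")
    case True
    then obtain s where s: "0 < s" "s0 \<le> s" "s < r" "disc_norm y s Q \<le> T * disc_norm y s P" by blast
    have P: "disc_norm y s P > 0" using s nz by (intro disc_norm_pos)
    have T: "T \<ge> 0"
      using disc_norm_pos[OF s(1) nz(2), of y] s(4) P by (smt (verit) mult_nonneg_nonneg mult_neg_pos)
    \<comment> \<open>If \<open>P\<close> had at least as many roots in \<open>?D\<close> as
      \<open>Q\<close>, its norm would grow at least as fast from \<open>s\<close> to
      \<open>r\<close>, and the inequality at \<open>s\<close> would persist at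
      \<open>r\<close>.\<close>
    have "(\<Sum>c\<in>?D. order c P) < (\<Sum>c\<in>?D. order c Q)"
    proof (rule ccontr)
      assume "\<not> ?thesis"
      then have "(r / s) ^ (\<Sum>c\<in>?D. order c Q) \<le> (r / s) ^ (\<Sum>c\<in>?D. order c P)"
        using s by (intro power_increasing) auto
      then have "disc_norm y s Q * (r / s) ^ (\<Sum>c\<in>?D. order c Q)
          \<le> T * disc_norm y s P * (r / s) ^ (\<Sum>c\<in>?D. order c P)"
        using s r P T by (intro mult_mono) auto
      then have "disc_norm y r Q \<le> T * disc_norm y r P"
        using scale[OF s(1-3) nz(2) S(3)] scale[OF s(1-3) nz(1) S(2)] by simp
      then show False using less.prems(4) center by simp
    qed
    then have "inner_order S y s P < inner_order S y s Q"
      unfolding inner_order_def inner[OF s(2,3)] .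
    then show ?thesis
      using s y ratio[OF s(1-3)] center by (intro exI[of _ y] exI[of _ s]) auto
  next
    case False
    show ?thesis
    proof (cases "s0 = 0")
      case True
      \<comment> \<open>Now \<open>y\<close> is the only point of \<open>S\<close> in the disc. As
        \<open>h y \<le> 0\<close>, it is a root of \<open>W\<close> but not of
        \<open>P * Q\<close>, and \<open>crit\<close> at \<open>y\<close> gives a forbidden radius,
        namely \<open>r / 2\<close>.\<close>
      then have Dy: "?D = {y}" using s0_ge y nonneg eq_0_iff
        by (auto simp: dual_order.antisym) (metis (no_types, lifting) antisym eq_iff_diff_eq_0 mem_Collect_eq)
      then have "h y \<le> 0" using less.prems(3) by simp
      then have PQy: "poly P y \<noteq> 0" "poly Q y \<noteq> 0" using pos[of y] by auto
      then have Wy: "poly W y = 0" using y by (simp add: S_def)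
      have far: "r / 2 \<le> v (y - c)" if "c \<in> S" "c \<noteq> y" for c
        using that D[of c] Dy r by force
      have "disc_norm y (r / 2) p = v (poly p y)"
        if "p \<noteq> 0" "{c. poly p c = 0} \<subseteq> S" "poly p y \<noteq> 0" for p
        using that far r by (intro disc_norm_point) auto
      then have "disc_norm y (r / 2) Q \<le> T * disc_norm y (r / 2) P"
        using crit[OF Wy PQy(1)] nz S PQy by simp
      moreover have "0 < r / 2" "s0 \<le> r / 2" "r / 2 < r" using True r by auto
      ultimately show ?thesis using False by blast
    next
      case s0_nz: False
      then have s0_pos: "s0 > 0" using s0 by simp
      \<comment> \<open>The classes are the open discs of radius \<open>s0\<close>. The sum of
        \<open>h\<close> is at most 0, hence below their number, so some class inherits a
        nonpositive sum.\<close>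
      have "card ((\<lambda>c. {d. v (c - d) < s0}) ` ?D) > 0" using S y by (subst card_gt_0_iff) auto
      then have "sum h ?D < int (card ((\<lambda>c. {d. v (c - d) < s0}) ` ?D))" using less.prems(3) by linarith
      then obtain w where w: "w \<in> ?D"
        "(\<Sum>c | c \<in> ?D \<and> {d. v (c - d) < s0} = {d. v (w - d) < s0}. h c) \<le> 0"
        using exists_class_nonpos[OF finite_subset[OF _ S(1)], of ?D h] by blast
      have "c \<in> ?D" if "c \<in> S" "v (w - c) < s0" for c
        using that w(1) s0 ultrametric[of "x - w" "w - c"] by auto
      then have cls: "{c. c \<in> ?D \<and> {d. v (c - d) < s0} = {d. v (w - d) < s0}} = {c \<in> S. v (w - c) < s0}"
        unfolding ball_eq_iff[OF s0_pos] by blast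
      have wy: "v (y - w) \<le> s0" using w s0_ge by auto
      have cent: "disc_norm w s0 p = disc_norm y s0 p" for p
        using disc_norm_center[OF s0_pos wy] by simp
      \<comment> \<open>The points \<open>y\<close> and \<open>z\<close> have distance
        \<open>s0\<close>, so no open disc of radius \<open>s0\<close> contains both. Hence the
        induction measure drops.\<close>
      have "{c \<in> S. v (w - c) < s0} \<subset> ?D"
      proof -
        have "\<not> (v (w - y) < s0 \<and> v (w - z) < s0)"
          using z(2) diff_le[of "w - z" "w - y"] by auto
        moreover have "y \<in> ?D" using y by simp
        moreover have "{c \<in> S. v (w - c) < s0} \<subseteq> ?D" unfolding cls[symmetric] by auto
        ultimately show ?thesis using z(1) by blast
      qed
      then have "card {c \<in> S. v (w - c) < s0} < card ?D" using S by (intro psubset_card_mono) auto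
      moreover have "{c \<in> S. v (w - c) < s0} \<noteq> {}" using w s0_pos by auto
      moreover have "(\<Sum>c | c \<in> S \<and> v (w - c) < s0. h c) \<le> 0" using w(2) unfolding cls .
      moreover have "T * disc_norm w s0 P < disc_norm w s0 Q"
        unfolding cent using False s0_pos s0 by (meson linorder_not_le order_refl)
      ultimately obtain b s where bs: "0 < s" "s \<le> s0" "v (w - b) \<le> s0" "disc_norm b s Q \<le> T * disc_norm b s P"
        "disc_norm b s W * disc_norm y s0 (P * Q) \<le> disc_norm y s0 W * disc_norm b s (P * Q)"
        "inner_order S b s P < inner_order S b s Q"
        using less.hyps[of w s0] s0_pos unfolding cent by blast
      have "v (x - b) \<le> r"
        using ultrametric[of "x - w" "w - b"] w bs s0 by auto
      moreover have "disc_norm b s W * disc_norm y r (P * Q) \<le> disc_norm y r W * disc_norm b s (P * Q)"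
      proof -
        let ?c = "disc_norm y s0 (P * Q)"
        have pos: "?c > 0" "disc_norm y r (P * Q) > 0" "disc_norm b s (P * Q) > 0"
          using nz s0_pos r bs by (auto intro: disc_norm_pos)
        have "disc_norm b s W * disc_norm y r (P * Q) * ?c
            \<le> disc_norm y s0 W * disc_norm b s (P * Q) * disc_norm y r (P * Q)"
          using mult_right_mono[OF bs(5), of "disc_norm y r (P * Q)"] pos by (simp add: mult_ac)
        also have "\<dots> \<le> disc_norm y r W * disc_norm b s (P * Q) * ?c"
          using mult_right_mono[OF ratio[of s0], of "disc_norm b s (P * Q)"] pos s0_pos s0 by (simp add: mult_ac)
        finally show ?thesis using pos by simp
      qed
      ultimately show ?thesis using bs s0 center by (intro exI[of _ b] exI[of _ s]) auto
    qed
  qed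
qed

section \<open>The critical point and its escaping orbit\<close>

lemma eps_le: "1 \<le> k \<Longrightarrow> k \<le> d \<Longrightarrow> eps v d \<le> v (of_nat k) ^ d"
  unfolding eps_def by (intro Min_le) auto

text \<open>The choice \<open>m = 1\<close> in the minimum gives
  \<open>eps v d \<le> 1\<close>.\<close>

lemma less_if_less_eps_mult:
  assumes "d \<ge> 1" "a < eps v d * b" "b > 0"
  shows "a < b"
proof -
  have "eps v d \<le> 1" using eps_le[of 1 d] assms by (simp add: one)
  then have "eps v d * b \<le> 1 * b" using assms by (intro mult_right_mono) auto
  then show ?thesis using assms by linarith
qed

text \<open>The normal form with fixed points at infinity and 0. The last conjunct says that beyond
  \<open>R\<close> the map multiplies absolute values by a constant, so a critical point whose image
  lies there must escape.\<close>

lemma exists_critical_point_outside: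
  fixes P Q :: "'a poly"
  assumes char: "CHAR('a) = 0 \<or> CHAR('a) > d"
    and deg: "degree Q = d" "Suc (degree P) = d" "d \<ge> 2"
    and cop: "coprime P Q"
    and Q0: "poly Q 0 = 0"
    and lc: "v (lead_coeff P) < eps v d * v (lead_coeff Q)"
  shows "\<exists>c R. R > 0 \<and> poly (wronskian Q P) c = 0 \<and> poly P c \<noteq> 0 \<and> R * v (poly P c) < v (poly Q c)
    \<and> (\<forall>z. v z > R \<longrightarrow> poly P z \<noteq> 0 \<and>
          v (poly Q z) * v (lead_coeff P) = v z * v (lead_coeff Q) * v (poly P z))"
proof -
  define W where "W = wronskian Q P"
  define S where "S = {c. poly (P * Q * W) c = 0}"
  define h where "h c = int (order c (P * Q)) - int (order c W)" for c
  define p q where "p = v (lead_coeff P)" and "q = v (lead_coeff Q)"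
  have of_nat_nz: "(of_nat k :: 'a) \<noteq> 0" if "0 < k" "k \<le> d" for k
    using that char by (auto simp: of_nat_eq_0_iff_char_dvd dest: dvd_imp_le)
  have nz: "P \<noteq> 0" "Q \<noteq> 0" using deg Q0 by auto
  then have pq: "p > 0" "q > 0" by (auto simp: p_def q_def pos_iff)
  have "p < q" using lc pq deg less_if_less_eps_mult[of d p q] by (simp add: p_def q_def)
  \<comment> \<open>The factor \<open>degree Q - degree P\<close> equals 1, so the top coefficient
    does not vanish.\<close>
  have coeffW: "coeff W (2 * d - 2) = lead_coeff Q * lead_coeff P"
  proof -
    have "(of_nat (degree Q) :: 'a) - of_nat (degree P) = 1"
      using deg by (metis add_diff_cancel_right' of_nat_Suc)
    then have "coeff ([:0, 1:] * W) (degree Q + degree P) = lead_coeff Q * lead_coeff P"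
      unfolding W_def coeff_x_mult_wronskian(1)[OF order_refl order_refl] by simp
    moreover have "degree Q + degree P = Suc (2 * d - 2)" using deg by simp
    ultimately show ?thesis by simp
  qed
  then have "W \<noteq> 0" using nz by auto
  moreover have "degree ([:0, 1:] * W) \<le> degree Q + degree P"
    unfolding W_def by (rule coeff_x_mult_wronskian) auto
  ultimately have "degree W \<le> 2 * d - 2" using deg by simp
  with coeffW have W: "W \<noteq> 0" "degree W = 2 * d - 2" "lead_coeff W = lead_coeff Q * lead_coeff P"
    using nz le_degree[of W "2 * d - 2"] by auto
  have S: "finite S" "{c. poly P c = 0} \<subseteq> S" "{c. poly Q c = 0} \<subseteq> S" "{c. poly W c = 0} \<subseteq> S"
    "{c. poly (P * Q) c = 0} \<subseteq> S"
    using nz W by (auto simp: S_def poly_roots_finite)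
  \<comment> \<open>By coprimality a root belongs to only one of \<open>P\<close> and
    \<open>Q\<close>; its order is at most \<open>d\<close>, hence nonzero in the field.\<close>
  have h_pos: "h c = 1" if "poly (P * Q) c = 0" for c
    proof -
    have ord: "(of_nat (order c f) :: 'a) \<noteq> 0" if "f \<noteq> 0" "poly f c = 0" "degree f \<le> d" for f
      using that order_root[of f c] order_degree[of f c] by (intro of_nat_nz) auto
    have "order c (P * Q) = Suc (order c W)"
    proof (cases "poly P c = 0")
      case True
      then have "poly Q c \<noteq> 0" using cop coprime_poly_0 by blast
      then show ?thesis
        using order_wronskian[OF nz(1) True _ ord] True nz deg by (simp add: W_def order_mult order_0I)
    next
      case False
      then have "poly Q c = 0" using that by simp
      then show ?thesis
        using order_wronskian[OF nz(2) _ False ord] False nz deg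
        by (simp add: W_def order_mult order_0I wronskian_commute[of Q P])
    qed
    then show ?thesis by (simp add: h_def)
  qed
  define R where "R = Max ((\<lambda>c. v c) ` {c. poly (P * Q) c = 0})"
  have fin: "finite {c. poly (P * Q) c = 0}" using nz by (intro poly_roots_finite) auto
  have R_ge: "v c \<le> R" if "poly (P * Q) c = 0" for c
    unfolding R_def using that fin by (intro Max_ge) auto
  have "R \<in> (\<lambda>c. v c) ` {c. poly (P * Q) c = 0}"
    unfolding R_def using Q0 fin by (intro Max_in) (auto intro: exI[of _ 0])
  then obtain a where a: "poly (P * Q) a = 0" "v a = R" by auto
  have R: "R > 0"
  proof -
    obtain a' where "poly P a' = 0" using alg_closed_imp_poly_has_root[of P] deg by auto
    moreover from this have "a' \<noteq> 0" using cop Q0 coprime_poly_0 by blast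
    ultimately show ?thesis using R_ge[of a'] pos_iff[of a'] by auto
  qed
  have large: "disc_norm 0 r f = v (lead_coeff f) * r ^ degree f"
    if "R \<le> r" "{c. poly f c = 0} \<subseteq> {c. v c \<le> R}" "f \<noteq> 0" for f r
    proof -
    have fin: "finite {c. poly f c = 0}" using that by (simp add: poly_roots_finite)
    have "(\<Prod>c | poly f c = 0. max r (v (0 - c)) ^ order c f) = (\<Prod>c | poly f c = 0. r ^ order c f)"
    proof (intro prod.cong refl)
      fix c assume "c \<in> {c. poly f c = 0}"
      then have "v c \<le> r" using that by auto
      then show "max r (v (0 - c)) ^ order c f = r ^ order c f" by (simp add: minus max_absorb1)
    qed
    then show ?thesis
      using disc_norm_roots[OF _ that(3) fin order_refl, of r 0] R that(1)
        degree_eq_sum_order[OF that(3) fin order_refl] by (simp add: power_sum)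
  qed
  have outside: "v (poly f z) = v (lead_coeff f) * v z ^ degree f"
    if "v z > R" "{c. poly f c = 0} \<subseteq> {c. v c \<le> R}" "f \<noteq> 0" for f z
    proof -
    have "v z \<le> v (z - c)" if "poly f c = 0" for c
      using ultrametric[of "z - c" c] that \<open>v z > R\<close> \<open>{c. poly f c = 0} \<subseteq> {c. v c \<le> R}\<close> by auto
    then have "v (poly f z) = disc_norm z (v z) f"
      using that R by (intro disc_norm_point[symmetric]) auto
    also have "\<dots> = disc_norm 0 (v z) f" using that R by (intro disc_norm_center) auto
    finally show ?thesis using large that by simp
  qed
  have PQ_in: "{c. poly P c = 0} \<subseteq> {c. v c \<le> R}" "{c. poly Q c = 0} \<subseteq> {c. v c \<le> R}"
    using R_ge by auto
  have far: "poly P z \<noteq> 0 \<and> v (poly Q z) * p = v z * q * v (poly P z)" if z: "v z > R" for z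
  proof -
    have "v z ^ d = v z * v z ^ degree P" using deg(2) by (metis power_Suc)
    then show ?thesis
      using outside[OF z PQ_in(1) nz(1)] outside[OF z PQ_in(2) nz(2)] deg(1) z PQ_in
      by (auto simp: p_def q_def)
  qed
  have "\<exists>c. poly W c = 0 \<and> poly P c \<noteq> 0 \<and> R * v (poly P c) < v (poly Q c)"
  proof (rule ccontr)
    assume "\<not> ?thesis"
    then have crit: "v (poly Q c) \<le> R * v (poly P c)" if "poly W c = 0" "poly P c \<noteq> 0" for c
      using that by force
    \<comment> \<open>A root \<open>c\<close> of \<open>W\<close> beyond \<open>R\<close> would have
      \<open>v (Q(c) / P(c)) = v c * q / p\<close>, which exceeds \<open>R\<close> because
      \<open>p < q\<close>.\<close>
    have W_in: "{c. poly W c = 0} \<subseteq> {c. v c \<le> R}"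
      proof (clarify, rule ccontr)
      fix c assume c: "poly W c = 0" "\<not> v c \<le> R"
      then have c': "poly P c \<noteq> 0" "v (poly Q c) * p = v c * q * v (poly P c)" using far[of c] by auto
      have "v c * q * v (poly P c) \<le> R * p * v (poly P c)"
        using mult_right_mono[OF crit[OF c(1) c'(1)], of p] pq unfolding c'(2) by (simp add: mult_ac)
      then have "v c * q \<le> R * p" using c'(1) by (simp add: pos_iff)
      moreover have "R * p < v c * q" using c \<open>p < q\<close> R pq by (intro mult_strict_mono) auto
      ultimately show False by simp
    qed
    have S_in: "v c \<le> R" if "c \<in> S" for c using that W_in PQ_in by (auto simp: S_def)
    \<comment> \<open>The degrees of \<open>P * Q\<close> and \<open>W\<close> are
      \<open>2 * d - 1\<close> and \<open>2 * d - 2\<close>.\<close>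
    have "(\<Sum>c\<in>S. h c) = 1"
      proof -
      have "(\<Sum>c\<in>S. h c) = int (degree (P * Q)) - int (degree W)"
        using degree_eq_sum_order[OF _ S(1,5)] degree_eq_sum_order[OF W(1) S(1,4)] nz
        by (simp add: h_def sum_subtractf)
      then show ?thesis using nz deg W by (simp add: degree_mult_eq)
    qed
    \<comment> \<open>The roots 0 and \<open>a\<close> of \<open>P * Q\<close> have distance
      \<open>R\<close>, so \<open>S\<close> meets at least two classes, while the total of
      \<open>h\<close> is 1.\<close>
    have "\<exists>w\<in>S. (\<Sum>c | c \<in> S \<and> v (w - c) < R. h c) \<le> 0"
      proof -
      let ?g = "\<lambda>c. {d. v (c - d) < R}"
      have "?g 0 \<noteq> ?g a" unfolding ball_eq_iff[OF R] using a by simp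
      then have "2 = card {?g 0, ?g a}" by simp
      also have "\<dots> \<le> card (?g ` S)"
      proof (rule card_mono)
        have "0 \<in> S" "a \<in> S" using a Q0 by (auto simp: S_def)
        then show "{?g 0, ?g a} \<subseteq> ?g ` S" by blast
      qed (use S in simp)
      finally have "sum h S < int (card (?g ` S))" using \<open>(\<Sum>c\<in>S. h c) = 1\<close> by simp
      then obtain w where "w \<in> S" "(\<Sum>c | c \<in> S \<and> ?g c = ?g w. h c) \<le> 0"
        using exists_class_nonpos[OF S(1)] by blast
      then show ?thesis unfolding ball_eq_iff[OF R] by blast
    qed
    then obtain w where w: "w \<in> S" "(\<Sum>c | c \<in> S \<and> v (w - c) < R. h c) \<le> 0" by blast
    have cent: "disc_norm w R f = disc_norm 0 R f" for f
      using S_in[OF w(1)] R by (intro disc_norm_center) auto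
    have degP: "degree P = d - 1" using deg by simp
    have dn: "disc_norm 0 R P = p * R ^ (d - 1)" "disc_norm 0 R Q = q * R ^ d"
      "disc_norm 0 R W = p * q * R ^ (2 * d - 2)"
      using large[OF order_refl PQ_in(1) nz(1)] large[OF order_refl PQ_in(2) nz(2)]
        large[OF order_refl W_in W(1)] deg(1) degP W(2,3) by (simp_all add: p_def q_def mult mult_ac)
    have Rd: "R ^ d = R * R ^ (d - 1)" using deg by (metis power_Suc diff_Suc_1)
    have "\<exists>b s. 0 < s \<and> s \<le> R \<and> v (w - b) \<le> R \<and> disc_norm b s Q \<le> R * disc_norm b s P \<and>
      disc_norm b s W * disc_norm w R (P * Q) \<le> disc_norm w R W * disc_norm b s (P * Q) \<and>
      inner_order S b s P < inner_order S b s Q"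
      unfolding S_def
    proof (rule descent[OF nz W(1) _ _ R])
      show "R * disc_norm w R P < disc_norm w R Q"
        unfolding cent dn Rd using \<open>p < q\<close> R by (simp add: mult_ac)
    qed (use crit h_pos w R in \<open>auto simp: h_def S_def\<close>)
    then obtain b s where bs: "0 < s" "s \<le> R" "v (w - b) \<le> R" "disc_norm b s Q \<le> R * disc_norm b s P"
      "disc_norm b s W * disc_norm w R (P * Q) \<le> disc_norm w R W * disc_norm b s (P * Q)"
      "inner_order S b s P < inner_order S b s Q" by blast
    have centb: "disc_norm b R f = disc_norm 0 R f" for f
      using disc_norm_center[OF R bs(3)] cent by simp
    \<comment> \<open>The excess of zeros over poles of \<open>Q / P\<close> in the disc reached by
      the descent; it is positive by \<open>bs(6)\<close> and at most
      \<open>degree Q\<close>.\<close>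
    define k where "k = inner_order S b s Q - inner_order S b s P"
    have k: "1 \<le> k" "k \<le> d"
      proof -
      have "inner_order S b s Q \<le> (\<Sum>c\<in>S. order c Q)"
        unfolding inner_order_def using S by (intro sum_mono2) auto
      then show "1 \<le> k" "k \<le> d"
        using bs(6) degree_eq_sum_order[OF nz(2) S(1,3)] deg by (auto simp: k_def)
    qed
    have wr: "v (of_nat k) * disc_norm b s (P * Q) \<le> s * disc_norm b s W"
      using disc_norm_wronskian[OF bs(1) nz S(1-3), of b] bs(6)
      unfolding k_def inner_order_def W_def by (simp add: of_nat_diff)
    \<comment> \<open>At radius \<open>R\<close> the norm of \<open>P * Q\<close> is exactly
      \<open>R\<close> times that of \<open>W\<close>. The descent does not increase the ratio of
      \<open>W\<close> to \<open>P * Q\<close>, so \<open>wr\<close> turns into a bound on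
      \<open>s\<close>.\<close>
    have ks: "v (of_nat k) * R \<le> s"
      proof -
      have pos: "disc_norm b s (P * Q) > 0" "disc_norm w R W > 0" "disc_norm w R (P * Q) > 0"
        using nz W bs R by (auto intro: disc_norm_pos)
      have "2 * d - 2 = d - 1 + (d - 1)" using deg by simp
      then have "disc_norm w R (P * Q) = R * disc_norm w R W"
        unfolding disc_norm_mult[OF R] cent dn Rd by (simp add: power_add)
      then have "v (of_nat k) * R * disc_norm w R W * disc_norm b s (P * Q)
          = (v (of_nat k) * disc_norm b s (P * Q)) * disc_norm w R (P * Q)" by simp
      also have "\<dots> \<le> s * disc_norm b s W * disc_norm w R (P * Q)"
        using wr pos by (intro mult_right_mono) auto
      also have "\<dots> \<le> s * disc_norm w R W * disc_norm b s (P * Q)"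
        using mult_left_mono[OF bs(5), of s] bs(1) by (simp add: mult_ac)
      finally show ?thesis using pos by simp
    qed
    have "eps v d \<le> v (of_nat k) ^ d" using k by (rule eps_le)
    also have "\<dots> \<le> (s / R) ^ d" using ks R by (intro power_mono) (auto simp: field_simps nonneg)
    finally have "eps v d * q \<le> (s / R) ^ d * q" using pq by (simp add: mult_right_mono)
    \<comment> \<open>From radius \<open>R\<close> to \<open>s\<close> the norm of \<open>Q\<close>
      drops at most by the factor \<open>(R / s)^d\<close>, while that of \<open>P\<close> does not
      increase. Comparing both at \<open>s\<close> bounds \<open>p / q\<close> below by
      \<open>(s / R)^d\<close>.\<close>
    moreover have "(s / R) ^ d * q * R ^ d \<le> p * R ^ d"
    proof -
      have "(s / R) ^ d * q * R ^ d \<le> disc_norm b s Q"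
        using disc_norm_shrink[OF bs(1,2), of b Q] unfolding centb dn deg by (simp add: mult_ac)
      also have "\<dots> \<le> R * disc_norm b s P" by (fact bs)
      also have "\<dots> \<le> R * disc_norm b R P" using disc_norm_mono[OF bs(1,2)] R by simp
      also have "\<dots> = p * R ^ d" unfolding centb dn Rd by simp
      finally show ?thesis .
    qed
    ultimately show False using lc R by (simp add: p_def q_def)
  qed
  then show ?thesis using far R unfolding W_def p_def q_def by blast
qed

text \<open>Translating some finite fixed point to 0 produces the normal form, and the expansion
  beyond \<open>R\<close> is then iterated.\<close>

lemma exists_escaping_critical_orbit:
  fixes P Q :: "'a poly"
  assumes char: "CHAR('a) = 0 \<or> CHAR('a) > d"
    and deg: "degree Q = d" "Suc (degree P) = d" "d \<ge> 2"
    and cop: "coprime P Q"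
    and lc: "v (lead_coeff P) < eps v d * v (lead_coeff Q)"
  obtains z where "poly (wronskian Q P) (z 0) = 0" "\<And>n. poly P (z n) \<noteq> 0"
    "\<And>n. z (Suc n) = poly Q (z n) / poly P (z n)" "filterlim (\<lambda>n. v (z n)) at_top sequentially"
proof -
  have nz: "P \<noteq> 0" "Q \<noteq> 0" using deg by auto
  then have pq: "v (lead_coeff P) > 0" "v (lead_coeff Q) > 0" by (auto simp: pos_iff)
  have lt: "v (lead_coeff P) < v (lead_coeff Q)"
    using less_if_less_eps_mult[OF _ lc] pq deg by simp
  \<comment> \<open>Finite fixed points are the roots of \<open>Q - z P\<close>. Its coefficient at
    \<open>d\<close> is nonzero because the leading coefficients have different absolute
    values.\<close>
  have "coeff ([:0, 1:] * P) (Suc (degree P)) = lead_coeff P" by simp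
  then have "coeff (Q - [:0, 1:] * P) d = lead_coeff Q - lead_coeff P" unfolding deg(2) using deg(1) by simp
  moreover have "lead_coeff Q \<noteq> lead_coeff P" using lt by auto
  ultimately have "d \<le> degree (Q - [:0, 1:] * P)" by (intro le_degree) auto
  then obtain x where "poly (Q - [:0, 1:] * P) x = 0"
    using alg_closed_imp_poly_has_root[of "Q - [:0, 1:] * P"] deg by auto
  then have x: "poly Q x = x * poly P x" by simp
  \<comment> \<open>\<open>Q1 / P1\<close> is the conjugate of \<open>Q / P\<close> by the
    translation \<open>z = y + x\<close>, so it fixes 0.\<close>
  define P1 Q1 where "P1 = pcompose P [:x, 1:]" and "Q1 = pcompose (Q - smult x P) [:x, 1:]"
  have degQ: "degree (Q - smult x P) = d"
    using degree_add_eq_left[of "- smult x P" Q] degree_smult_le[of x P] deg by simp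
  have lcQ: "lead_coeff (Q - smult x P) = lead_coeff Q" unfolding degQ using deg by (simp add: coeff_eq_0)
  have P1: "poly P1 y = poly P (y + x)" and Q1: "poly Q1 y = poly Q (y + x) - x * poly P (y + x)" for y
    by (simp_all add: P1_def Q1_def poly_pcompose add.commute)
  have W1: "poly (wronskian Q1 P1) y = poly (wronskian Q P) (y + x)" for y
    by (simp add: wronskian_def P1_def Q1_def pderiv_pcompose pderiv_pCons pderiv_diff pderiv_smult
        poly_pcompose add.commute algebra_simps)
  have "coprime P1 Q1"
  proof (subst coprime_iff_no_common_root)
    show "P1 \<noteq> 0" using nz by (simp add: P1_def pcompose_eq_0_iff)
    show "\<forall>z. poly P1 z = 0 \<longrightarrow> poly Q1 z \<noteq> 0" using cop coprime_poly_0 by (auto simp: P1 Q1)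
  qed
  moreover have "lead_coeff P1 = lead_coeff P" "lead_coeff Q1 = lead_coeff Q"
    using lcQ by (simp_all add: P1_def Q1_def lead_coeff_comp)
  ultimately obtain c R where c: "R > 0" "poly (wronskian Q1 P1) c = 0" "poly P1 c \<noteq> 0"
      "R * v (poly P1 c) < v (poly Q1 c)"
    and out: "\<And>y. v y > R \<Longrightarrow> poly P1 y \<noteq> 0 \<and>
      v (poly Q1 y) * v (lead_coeff P) = v y * v (lead_coeff Q) * v (poly P1 y)"
    using exists_critical_point_outside[OF char, of Q1 P1] deg degQ lc x
    by (auto simp: P1_def Q1_def degree_pcompose poly_pcompose)
  define z where "z n = ((\<lambda>z. poly Q z / poly P z) ^^ n) (c + x)" for n
  define y where "y n = z n - x" for n
  define t where "t = v (lead_coeff Q) / v (lead_coeff P)"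
  have z_Suc: "z (Suc n) = poly Q (z n) / poly P (z n)" for n by (simp add: z_def)
  have y_Suc: "y (Suc n) = poly Q1 (y n) / poly P1 (y n)" if "poly P1 (y n) \<noteq> 0" for n
    using that by (simp add: y_def z_Suc P1 Q1 divide_simps)
  have y0: "y 0 = c" by (simp add: y_def z_def)
  have t: "t > 1" using lt pq by (simp add: t_def)
  have step: "v (y (Suc n)) = v (y n) * t" if "v (y n) > R" for n
    using out[OF that] pq by (simp add: y_Suc divide t_def pos_iff eq_0_iff field_simps)
  have "v (y 1) = v (poly Q1 c) / v (poly P1 c)" using c(3) y_Suc[of 0] by (simp add: y0 divide)
  then have "v (y 1) > R" using c(3,4) by (simp add: pos_less_divide_eq pos_iff)
  \<comment> \<open>The growth is claimed only from index 1 on: the critical point \<open>c\<close>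
    itself may lie in the disc of radius \<open>R\<close>.\<close>
  then have y_pow: "v (y (Suc n)) = v (y 1) * t ^ n \<and> v (y (Suc n)) > R" for n
  proof (induction n)
    case (Suc n)
    then have IH: "v (y (Suc n)) = v (y 1) * t ^ n" "v (y (Suc n)) > R" by auto
    have "v (y (Suc n)) * 1 < v (y (Suc n)) * t" using t IH(2) c(1) by (intro mult_strict_left_mono) auto
    then show ?case using step[OF IH(2)] IH by simp
  qed simp
  have P_nz: "poly P (z n) \<noteq> 0" for n
  proof (cases n)
    case 0
    then show ?thesis using c(3) by (simp add: z_def P1)
  next
    case (Suc m)
    then have "poly P1 (y n) \<noteq> 0" using out y_pow[of m] by blast
    then show ?thesis by (simp add: P1 y_def)
  qed
  have "filterlim (\<lambda>n. v (y 1) * t ^ n) at_top sequentially"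
    using \<open>v (y 1) > R\<close> c(1) t
    by (intro filterlim_tendsto_pos_mult_at_top[OF tendsto_const] filterlim_at_infinity_imp_filterlim_at_top
        filterlim_realpow_sequentially_gt1) auto
  moreover have "(\<lambda>n. v (y (Suc n))) = (\<lambda>n. v (y 1) * t ^ n)" using y_pow by blast
  ultimately have "filterlim (\<lambda>n. v (y (Suc n))) at_top sequentially" by (simp only:)
  then have lim: "filterlim (\<lambda>n. v (y n)) at_top sequentially"
    by (rule filterlim_sequentially_Suc[THEN iffD1])
  have "filterlim (\<lambda>n. v (z n)) at_top sequentially"
  proof (rule filterlim_at_top_mono[OF lim])
    have "\<forall>\<^sub>F n in sequentially. v (y n) > v x" using lim by (simp add: filterlim_at_top_dense)
    then show "\<forall>\<^sub>F n in sequentially. v (y n) \<le> v (z n)"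
    proof eventually_elim
      case (elim n)
      then show ?case using diff_le[of "z n" x] by (simp add: y_def)
    qed
  qed
  moreover have "poly (wronskian Q P) (z 0) = 0" using c(2) by (simp add: z_def W1)
  ultimately show thesis using that P_nz z_Suc by blast
qed

end

section \<open>Rational functions on the projective line\<close>

lemma dvd_if_order_le:
  fixes p q :: "'b :: alg_closed_field poly"
  assumes "p \<noteq> 0" "q \<noteq> 0" "\<And>c. order c p \<le> order c q"
  shows "p dvd q"
proof -
  define S where "S = {c. poly (p * q) c = 0}"
  have S: "finite S" "{c. poly p c = 0} \<subseteq> S" "{c. poly q c = 0} \<subseteq> S"
    using assms by (auto simp: S_def poly_roots_finite)
  have "(\<Prod>c\<in>S. [:- c, 1:] ^ order c p) dvd (\<Prod>c\<in>S. [:- c, 1:] ^ order c q)"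
    using assms(3) by (intro prod_dvd_prod le_imp_power_dvd)
  then have "smult (lead_coeff p) (\<Prod>c\<in>S. [:- c, 1:] ^ order c p)
      dvd smult (lead_coeff q) (\<Prod>c\<in>S. [:- c, 1:] ^ order c q)"
    using assms by (intro smult_dvd dvd_smult) auto
  then show ?thesis
    using splits_over_roots[OF assms(1) S(1,2)] splits_over_roots[OF assms(2) S(1,3)] by simp
qed

text \<open>Compare orders at each point: where \<open>q\<close> vanishes \<open>p\<close> does not,
  so the cross relation forces \<open>q'\<close> to absorb the order of \<open>q\<close>.\<close>

lemma denominator_dvd:
  fixes p q :: "'b :: alg_closed_field poly"
  assumes "coprime p q" "q \<noteq> 0" "q' \<noteq> 0" "p * q' = p' * q"
  shows "q dvd q'"
proof (cases "p = 0")
  case True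
  then show ?thesis using assms(1) by (simp add: unit_imp_dvd)
next
  case False
  then have "p' \<noteq> 0" using assms by auto
  show ?thesis
  proof (rule dvd_if_order_le[OF assms(2,3)])
    fix c
    have "order c p + order c q' = order c p' + order c q"
      using order_mult[of p q' c] order_mult[of p' q c] assms False \<open>p' \<noteq> 0\<close> by (metis no_zero_divisors)
    moreover have "order c p = 0 \<or> order c q = 0"
      using coprime_poly_0[OF assms(1), of c] order_0I[of p c] order_0I[of q c] by argo
    ultimately show "order c q \<le> order c q'" by auto
  qed
qed

text \<open>Each denominator divides the other, so they differ by a unit, that is, by a nonzero
  constant.\<close>

lemma lowest_terms_unique:
  fixes f :: "'b :: alg_closed_field poly fract"
  assumes "lowest_terms f (p, q)" "lowest_terms f (p', q')"
  obtains c where "c \<noteq> 0" "p' = smult c p" "q' = smult c q"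
proof -
  from assms have nz: "q \<noteq> 0" "q' \<noteq> 0" and cop: "coprime p q" "coprime p' q'" and eq: "p * q' = p' * q"
    by (auto simp: lowest_terms_def eq_fract)
  have "q dvd q'" using denominator_dvd[OF cop(1) nz eq] .
  moreover have "q' dvd q" using denominator_dvd[OF cop(2) nz(2,1) eq[symmetric]] .
  ultimately obtain a b where ab: "q' = q * a" "q = q' * b" by (elim dvdE)
  then have "q * (a * b) = q * 1" by (metis mult.assoc mult_1_right)
  then have "a * b = 1" unfolding mult_cancel_left using nz(1) by blast
  then have "is_unit a" by (intro dvdI[of _ _ b]) simp
  then obtain c where c: "a = [:c:]" by (auto simp: is_unit_poly_iff)
  then have "c \<noteq> 0" using ab nz by auto
  then have q': "q' = smult c q" using ab(1) c by simp
  then have "p' * q = smult c p * q" using eq by simp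
  then have "p' = smult c p" unfolding mult_cancel_right using nz(1) by blast
  then show thesis using that \<open>c \<noteq> 0\<close> q' by blast
qed

lemma rat_eval_lowest_terms:
  fixes f :: "'b :: alg_closed_field poly fract"
  assumes "lowest_terms f (p, q)"
  shows "rat_eval f a = (if poly q a = 0 then Infty else Fin (poly p a / poly q a))"
proof -
  obtain c where "c \<noteq> 0" "rat_num f = smult c p" "rat_den f = smult c q"
    using lowest_terms_unique[OF assms lowest_terms_rat] .
  then show ?thesis by (simp add: rat_eval_def)
qed

lemma rat_deriv_lowest_terms:
  fixes f :: "'b :: alg_closed_field poly fract"
  assumes "lowest_terms f (p, q)"
  shows "rat_deriv f a = poly (wronskian p q) a / poly q a ^ 2"
proof -
  obtain c where c: "c \<noteq> 0" "rat_num f = smult c p" "rat_den f = smult c q"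
    using lowest_terms_unique[OF assms lowest_terms_rat] .
  have "rat_deriv f a = (c ^ 2 * poly (wronskian p q) a) / (c ^ 2 * poly q a ^ 2)"
    by (simp add: rat_deriv_def Let_def c(2,3) pderiv_smult wronskian_def power2_eq_square algebra_simps)
  then show ?thesis using c(1) by simp
qed

lemma lowest_terms_inverse:
  assumes "lowest_terms f (p, q)" "p \<noteq> 0"
  shows "lowest_terms (inverse f) (q, p)"
  using assms by (auto simp: lowest_terms_def coprime_commute)

section \<open>Reversal \<open>z^d p(1/z)\<close> relative to a fixed degree bound \<open>d\<close>,
  for the coordinate \<open>1/z\<close>\<close>

definition reversed_poly :: "nat \<Rightarrow> 'b :: field poly \<Rightarrow> 'b poly" where
  "reversed_poly d p = (\<Sum>i\<le>d. monom (coeff p i) (d - i))"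

lemma coeff_reversed_poly: "i \<le> d \<Longrightarrow> coeff (reversed_poly d p) i = coeff p (d - i)"
proof -
  assume "i \<le> d"
  have "coeff (reversed_poly d p) i = (\<Sum>j\<le>d. if j = d - i then coeff p j else 0)"
    unfolding reversed_poly_def coeff_sum coeff_monom using \<open>i \<le> d\<close> by (intro sum.cong) auto
  then show ?thesis by (simp add: sum.delta)
qed

lemma degree_reversed_poly_le: "degree (reversed_poly d p) \<le> d"
  unfolding reversed_poly_def by (intro degree_sum_le order.trans[OF degree_monom_le]) auto

lemma poly_eq_sum_le: "degree p \<le> d \<Longrightarrow> poly p x = (\<Sum>i\<le>d. coeff p i * x ^ i)"
  for p :: "'b :: field poly"
  unfolding poly_altdef by (intro sum.mono_neutral_left) (auto simp: coeff_eq_0)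

lemma poly_reversed_poly:
  assumes "degree p \<le> d" "z \<noteq> 0"
  shows "poly (reversed_poly d p) z = z ^ d * poly p (1 / z)"
  unfolding poly_eq_sum_le[OF assms(1)] reversed_poly_def poly_sum poly_monom sum_distrib_left
  using assms(2) by (intro sum.cong) (auto simp: power_diff power_one_over divide_simps)

text \<open>Reversal turns the exponent \<open>i\<close> into \<open>d - i\<close>, so
  \<open>z d/dz\<close> becomes \<open>d - w d/dw\<close> at \<open>w = 1/z\<close>.\<close>

lemma poly_pderiv_reversed_poly:
  fixes p :: "'b :: field poly"
  assumes "degree p \<le> d" "z \<noteq> 0"
  shows "z * poly (pderiv (reversed_poly d p)) z
    = z ^ d * (of_nat d * poly p (1 / z) - 1 / z * poly (pderiv p) (1 / z))"
proof -
  have D: "x * poly (pderiv q) x = (\<Sum>i\<le>d. of_nat i * coeff q i * x ^ i)" if "degree q \<le> d"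
    for q :: "'b poly" and x
  proof -
    have "coeff ([:0, 1:] * pderiv q) i = of_nat i * coeff q i" for i
      by (cases i) (auto simp: coeff_pderiv)
    moreover from this have "degree ([:0, 1:] * pderiv q) \<le> d"
      using that by (intro degree_le) (auto simp: coeff_eq_0)
    ultimately show ?thesis
      using poly_eq_sum_le[of "[:0, 1:] * pderiv q" d x] by simp
  qed
  have "z * poly (pderiv (reversed_poly d p)) z = (\<Sum>i\<le>d. of_nat i * coeff p (d - i) * z ^ i)"
    unfolding D[OF degree_reversed_poly_le] by (intro sum.cong) (auto simp: coeff_reversed_poly)
  also have "\<dots> = (\<Sum>i\<le>d. of_nat (d - i) * coeff p i * z ^ (d - i))"
    by (rule sum.reindex_bij_witness[where i = "\<lambda>i. d - i" and j = "\<lambda>i. d - i"]) auto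
  also have "\<dots> = (\<Sum>i\<le>d. z ^ d * (of_nat d * (coeff p i * (1 / z) ^ i) - of_nat i * coeff p i * (1 / z) ^ i))"
    using assms(2) by (intro sum.cong) (auto simp: of_nat_diff power_diff power_one_over field_simps)
  also have "\<dots> = z ^ d * (of_nat d * poly p (1 / z) - 1 / z * poly (pderiv p) (1 / z))"
    unfolding D[OF assms(1)] poly_eq_sum_le[OF assms(1)]
    by (simp add: sum_subtractf sum_distrib_left[symmetric])
  finally show ?thesis .
qed

text \<open>The chain rule for \<open>1/z\<close>: the terms with factor \<open>d\<close> cancel by
  antisymmetry.\<close>

lemma poly_wronskian_reversed_poly:
  fixes p q :: "'b :: field poly"
  assumes "degree p \<le> d" "degree q \<le> d" "z \<noteq> 0"
  shows "z * poly (wronskian (reversed_poly d q) (reversed_poly d p)) z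
    = - (z ^ d * z ^ d * (1 / z) * poly (wronskian q p) (1 / z))"
proof -
  have "z * poly (wronskian (reversed_poly d q) (reversed_poly d p)) z
    = (z * poly (pderiv (reversed_poly d q)) z) * poly (reversed_poly d p) z
      - poly (reversed_poly d q) z * (z * poly (pderiv (reversed_poly d p)) z)"
    by (simp add: wronskian_def algebra_simps)
  also have "\<dots> = - (z ^ d * z ^ d * (1 / z) * poly (wronskian q p) (1 / z))"
    unfolding poly_pderiv_reversed_poly[OF assms(1,3)] poly_pderiv_reversed_poly[OF assms(2,3)]
      poly_reversed_poly[OF assms(1,3)] poly_reversed_poly[OF assms(2,3)] wronskian_def poly_diff poly_mult
    by algebra
  finally show ?thesis .
qed

lemma poly_wronskian_reversed_poly_0:
  assumes "d \<ge> 1"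
  shows "poly (wronskian (reversed_poly d q) (reversed_poly d p)) 0
    = coeff q (d - 1) * coeff p d - coeff q d * coeff p (d - 1)"
  using assms by (simp add: wronskian_def poly_0_coeff_0 coeff_pderiv coeff_mult_0 coeff_reversed_poly)

lemma reversed_poly_eq:
  assumes "degree p \<le> d"
  shows "reversed_poly d p = monom 1 (d - degree p) * reflect_poly p"
proof (rule poly_eqI)
  fix n
  show "coeff (reversed_poly d p) n = coeff (monom 1 (d - degree p) * reflect_poly p) n"
  proof (cases "n \<le> d")
    case True
    then show ?thesis using assms
      by (auto simp: coeff_reversed_poly coeff_monom_mult coeff_reflect_poly coeff_eq_0)
  next
    case False
    then show ?thesis using assms degree_reversed_poly_le[of d p]
      by (auto simp: coeff_monom_mult coeff_reflect_poly coeff_eq_0)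
  qed
qed

text \<open>A common root at 0 would kill both coefficients at \<open>d\<close>; any other common
  root \<open>z\<close> gives the common root \<open>1/z\<close> of \<open>p\<close> and
  \<open>q\<close>.\<close>

lemma coprime_reversed_poly:
  fixes p q :: "'b :: alg_closed_field poly"
  assumes "coprime p q" "degree p \<le> d" "degree q \<le> d" "coeff p d \<noteq> 0 \<or> coeff q d \<noteq> 0"
    "reversed_poly d p \<noteq> 0"
  shows "coprime (reversed_poly d p) (reversed_poly d q)"
proof (subst coprime_iff_no_common_root[OF assms(5)], intro allI impI notI)
  fix z assume z: "poly (reversed_poly d p) z = 0" "poly (reversed_poly d q) z = 0"
  show False
  proof (cases "z = 0")
    case True
    then show False using z assms(4) by (simp add: poly_0_coeff_0 coeff_reversed_poly)
  next
    case False
    then show False using z assms coprime_poly_0[of p q "1 / z"] by (simp add: poly_reversed_poly)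
  qed
qed

text \<open>Criticality of infinity is read off from the two top coefficients, so their behaviour
  under translation is recorded here.\<close>

lemma coeff_shift:
  fixes p :: "'b :: field poly"
  assumes "degree p \<le> Suc n"
  shows "coeff (pcompose p [:a, 1:]) (Suc n) = coeff p (Suc n)"
    and "coeff (pcompose p [:a, 1:]) n = coeff p n + of_nat (Suc n) * a * coeff p (Suc n)"
proof -
  have "coeff (pcompose p [:a, 1:]) (Suc n) = coeff p (Suc n) \<and>
    coeff (pcompose p [:a, 1:]) n = coeff p n + of_nat (Suc n) * a * coeff p (Suc n)"
    using assms
  proof (induction n arbitrary: p)
    case 0
    obtain c p' where p: "p = pCons c p'" by (cases p)
    with 0 have "degree p' = 0" by (auto split: if_splits)
    then obtain b where "p' = [:b:]" by (auto elim: degree_eq_zeroE)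
    then show ?case using p by (simp add: pcompose_pCons)
  next
    case (Suc n)
    obtain c p' where p: "p = pCons c p'" by (cases p)
    with Suc.prems have deg: "degree p' \<le> Suc n" by (auto split: if_splits)
    then have "coeff (pcompose p' [:a, 1:]) (Suc (Suc n)) = 0"
      using degree_pcompose_le[of p' "[:a, 1:]"] by (intro coeff_eq_0) auto
    then show ?case using Suc.IH[OF deg] deg
      by (simp add: p pcompose_pCons coeff_eq_0 algebra_simps)
  qed
  then show "coeff (pcompose p [:a, 1:]) (Suc n) = coeff p (Suc n)"
    "coeff (pcompose p [:a, 1:]) n = coeff p n + of_nat (Suc n) * a * coeff p (Suc n)" by auto
qed

section \<open>Values, derivatives and critical points of a rational map in coordinates\<close>

context
  fixes f :: "'b :: alg_closed_field poly fract" and d :: nat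
  assumes deg: "rat_degree f = d" and d: "d \<ge> 1"
begin

lemma rat_degrees: "degree (rat_num f) \<le> d" "degree (rat_den f) \<le> d"
    "coeff (rat_num f) d \<noteq> 0 \<or> coeff (rat_den f) d \<noteq> 0"
proof -
  have "d = degree (rat_num f) \<or> d = degree (rat_den f)" using deg by (auto simp: rat_degree_def)
  moreover have "coeff p d \<noteq> 0" if "d = degree p" for p :: "'b poly" using that d by auto
  ultimately show "coeff (rat_num f) d \<noteq> 0 \<or> coeff (rat_den f) d \<noteq> 0" by blast
qed (use deg in \<open>auto simp: rat_degree_def\<close>)

lemma rat_num_nz: "rat_num f \<noteq> 0"
proof
  assume "rat_num f = 0"
  then have "is_unit (rat_den f)" using lowest_terms_rat[of f] by (auto simp: lowest_terms_def)
  then have "degree (rat_den f) = 0" by (auto simp: is_unit_poly_iff)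
  then show False using \<open>rat_num f = 0\<close> deg d by (simp add: rat_degree_def)
qed

text \<open>The fraction defining \<open>rat_flip f\<close> agrees with this one up to powers of
  \<open>z\<close>. Reversing both polynomials relative to the common \<open>d\<close> keeps them
  from vanishing together at 0.\<close>

lemma lowest_terms_rat_flip:
  "lowest_terms (rat_flip f) (reversed_poly d (rat_num f), reversed_poly d (rat_den f))"
proof -
  define p q where "p = rat_num f" and "q = rat_den f"
  have pq: "coprime p q" "q \<noteq> 0" "p \<noteq> 0"
    using lowest_terms_rat[of f] rat_num_nz by (auto simp: lowest_terms_def p_def q_def)
  have le: "degree p \<le> d" "degree q \<le> d" using rat_degrees by (auto simp: p_def q_def)
  have nz: "reversed_poly d p \<noteq> 0" "reversed_poly d q \<noteq> 0" using le pq by (auto simp: reversed_poly_eq)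
  have "rat_flip f = Fract (reflect_poly p * monom 1 (degree q)) (reflect_poly q * monom 1 (degree p))"
    by (simp add: rat_flip_def p_def q_def Let_def)
  also have "\<dots> = Fract (reversed_poly d p) (reversed_poly d q)"
  proof -
    have main: "monom (1 :: 'b) (degree q) * monom 1 (d - degree q) = monom 1 (degree p) * monom 1 (d - degree p)"
      using le by (simp add: mult_monom)
    have "reflect_poly q * monom 1 (degree p) \<noteq> 0" using pq by simp
    moreover have "reflect_poly p * monom 1 (degree q) * reversed_poly d q
        = reversed_poly d p * (reflect_poly q * monom 1 (degree p))"
      unfolding reversed_poly_eq[OF le(1)] reversed_poly_eq[OF le(2)] using main by algebra
    ultimately show ?thesis using nz(2) by (simp only: eq_fract(1) not_False_eq_True)
  qed
  finally show ?thesis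
    using nz coprime_reversed_poly[OF pq(1) le _ nz(1)] rat_degrees(3)
    by (simp add: lowest_terms_def p_def q_def)
qed

lemma rat_map_Fin: "rat_map f (Fin x) = (if poly (rat_den f) x = 0 then Infty
    else Fin (poly (rat_num f) x / poly (rat_den f) x))"
  by (simp add: rat_eval_def)

lemma rat_map_Infty: "rat_map f Infty = (if coeff (rat_den f) d = 0 then Infty
    else Fin (coeff (rat_num f) d / coeff (rat_den f) d))"
  by (simp add: rat_eval_lowest_terms[OF lowest_terms_rat_flip] poly_0_coeff_0 coeff_reversed_poly)

lemma local_deriv_Fin:
  "local_deriv f (Fin x) = (if poly (rat_den f) x = 0
     then poly (wronskian (rat_den f) (rat_num f)) x / poly (rat_num f) x ^ 2
     else poly (wronskian (rat_num f) (rat_den f)) x / poly (rat_den f) x ^ 2)"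
  using rat_deriv_lowest_terms[OF lowest_terms_rat, of f]
    rat_deriv_lowest_terms[OF lowest_terms_inverse[OF lowest_terms_rat rat_num_nz]]
  by (simp add: local_deriv_def rat_eval_def)

lemma local_deriv_Infty:
  "local_deriv f Infty = (let p = reversed_poly d (rat_num f); q = reversed_poly d (rat_den f) in
     if coeff (rat_den f) d = 0 then poly (wronskian q p) 0 / poly p 0 ^ 2
     else poly (wronskian p q) 0 / poly q 0 ^ 2)"
proof -
  have "reversed_poly d (rat_num f) \<noteq> 0" using rat_num_nz rat_degrees by (auto simp: reversed_poly_eq)
  then show ?thesis
    using rat_deriv_lowest_terms[OF lowest_terms_rat_flip]
      rat_deriv_lowest_terms[OF lowest_terms_inverse[OF lowest_terms_rat_flip]]
    by (simp add: local_deriv_def rat_map_Infty Let_def del: rat_map.simps)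
qed

text \<open>The Wronskian is antisymmetric, so poles of \<open>f\<close>, where the coordinate
  \<open>1/z\<close> is used on the target, obey the same criterion.\<close>

lemma critical_point_Fin:
  "poly (wronskian (rat_num f) (rat_den f)) x = 0 \<Longrightarrow> critical_point f (Fin x)"
  by (auto simp: critical_point_def local_deriv_Fin wronskian_commute[of "rat_den f"])

lemma critical_point_Infty:
  "coeff (rat_num f) (d - 1) * coeff (rat_den f) d = coeff (rat_num f) d * coeff (rat_den f) (d - 1)
    \<Longrightarrow> critical_point f Infty"
  using d by (auto simp: critical_point_def local_deriv_Infty Let_def poly_wronskian_reversed_poly_0)

end

section \<open>Strictly attracted critical points\<close>

context alg_closed_nonarch
begin

lemma strictly_attracts_orbit:
  assumes "\<And>n. rat_map f (x n) = x (Suc n)" "\<And>n. x n \<noteq> g" "(\<lambda>n. chordal v (x n) g) \<longlonglongrightarrow> 0"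
  shows "strictly_attracts v f g (x 0)"
proof -
  have "(rat_map f ^^ n) (x 0) = x n" for n by (induction n) (auto simp: assms(1))
  then show ?thesis
    using assms(2,3)
    by (simp add: strictly_attracts_def attracts_def Metric_space.limitin_metric_dist_null[OF Metric_space_chordal])
qed

lemma chordal_nonneg: "chordal v x y \<ge> 0"
  using Metric_space.nonneg[OF Metric_space_chordal] by simp

text \<open>Here no change of coordinate is required. The multiplier is the quotient of the
  coefficients of \<open>P\<close> at \<open>d - 1\<close> and \<open>Q\<close> at \<open>d\<close>,
  and its being nonzero makes the degree of \<open>P\<close> exactly \<open>d - 1\<close>.\<close>

lemma strictly_attracted_critical_point_Infty:
  fixes f :: "'a poly fract"
  assumes char: "CHAR('a) = 0 \<or> CHAR('a) > d" and deg: "rat_degree f = d" and d: "d \<ge> 2"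
    and fixed: "fixed_point f Infty"
    and mult: "0 < v (local_deriv f Infty)" "v (local_deriv f Infty) < eps v d"
  shows "\<exists>c. critical_point f c \<and> strictly_attracts v f Infty c"
proof -
  define Q P where "Q = rat_num f" and "P = rat_den f"
  have d1: "d \<ge> 1" using d by simp
  note facts = rat_degrees[OF deg d1, folded Q_def P_def]
  have cop: "coprime P Q" and P: "P \<noteq> 0"
    using lowest_terms_rat[of f] by (auto simp: lowest_terms_def P_def Q_def coprime_commute)
  have Pd: "coeff P d = 0"
    using fixed rat_map_Infty[OF deg d1] by (auto simp: fixed_point_def P_def simp del: rat_map.simps split: if_splits)
  then have Qd: "coeff Q d \<noteq> 0" using facts by simp
  then have degQ: "degree Q = d" using facts(1) by (meson le_antisym le_degree)
  have deriv: "local_deriv f Infty = coeff P (d - 1) / coeff Q d"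
    using local_deriv_Infty[OF deg d1] Pd Qd poly_wronskian_reversed_poly_0[OF d1, of P Q]
    by (simp add: P_def Q_def poly_0_coeff_0 coeff_reversed_poly power2_eq_square)
  then have Pd1: "coeff P (d - 1) \<noteq> 0" using mult(1) by auto
  have "degree P \<noteq> d" using Pd P by auto
  then have degP: "Suc (degree P) = d"
    using facts(2) le_degree[OF Pd1] d1 by linarith
  have "lead_coeff P = local_deriv f Infty * lead_coeff Q"
    using deriv Qd degP degQ by (metis diff_Suc_1 nonzero_eq_divide_eq)
  then have "v (lead_coeff P) < eps v d * v (lead_coeff Q)"
    using mult(2) Qd degQ by (simp add: nonarch_absolute_value_axioms nonarch_absolute_value.mult pos_iff)
  then obtain z where z: "poly (wronskian Q P) (z 0) = 0" "\<And>n. poly P (z n) \<noteq> 0"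
      "\<And>n. z (Suc n) = poly Q (z n) / poly P (z n)"
    and lim: "filterlim (\<lambda>n. v (z n)) at_top sequentially"
    using exists_escaping_critical_orbit[OF char degQ degP d cop] by metis
  have "(\<lambda>n. chordal v (Fin (z n)) Infty) \<longlonglongrightarrow> 0"
  proof (rule tendsto_sandwich[OF _ _ tendsto_const tendsto_inverse_0_at_top[OF lim]])
    have "\<forall>\<^sub>F n in sequentially. v (z n) > 1" using lim by (simp add: filterlim_at_top_dense)
    then show "\<forall>\<^sub>F n in sequentially. chordal v (Fin (z n)) Infty \<le> inverse (v (z n))"
      by eventually_elim (simp add: chordal_def minus one divide_inverse)
  qed (simp add: chordal_nonneg)
  then have "strictly_attracts v f Infty (Fin (z 0))"
    using z by (intro strictly_attracts_orbit[of f "\<lambda>n. Fin (z n)"]) (auto simp: rat_eval_def P_def Q_def)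
  moreover have "critical_point f (Fin (z 0))"
    using critical_point_Fin[OF deg d1] z(1) by (simp add: P_def Q_def)
  ultimately show ?thesis by blast
qed

text \<open>Conjugation by \<open>x = a + 1/z\<close> moves the fixed point \<open>a\<close> to \<open>\<infinity>\<close>.\<close>
lemma strictly_attracted_critical_point_Fin:
  fixes f :: "'a poly fract"
  assumes char: "CHAR('a) = 0 \<or> CHAR('a) > d" and deg: "rat_degree f = d" and d: "d \<ge> 2"
    and fixed: "fixed_point f (Fin a)"
    and mult: "0 < v (local_deriv f (Fin a))" "v (local_deriv f (Fin a)) < eps v d"
  shows "\<exists>c. critical_point f c \<and> strictly_attracts v f (Fin a) c"
proof -
  define N D where "N = rat_num f" and "D = rat_den f"
  define N1 D1 where "N1 = pcompose (N - smult a D) [:a, 1:]" and "D1 = pcompose D [:a, 1:]"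
  \<comment> \<open>\<open>Q / P\<close> is \<open>1 / (f(a + 1/z) - a)\<close>, the conjugate of
    \<open>f\<close>.\<close>
  define Q P where "Q = reversed_poly d D1" and "P = reversed_poly d N1"
  have d1: "d \<ge> 1" using d by simp
  note facts = rat_degrees[OF deg d1, folded N_def D_def]
  have cop: "coprime N D" and D: "D \<noteq> 0"
    using lowest_terms_rat[of f] by (auto simp: lowest_terms_def N_def D_def)
  have Da: "poly D a \<noteq> 0" and Na: "poly N a = a * poly D a"
    using fixed by (auto simp: fixed_point_def rat_eval_def N_def D_def field_simps split: if_splits)
  have deriv: "local_deriv f (Fin a) = (poly (pderiv N) a - a * poly (pderiv D) a) / poly D a"
  proof -
    have "poly (wronskian N D) a = poly D a * (poly (pderiv N) a - a * poly (pderiv D) a)"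
      by (simp add: wronskian_def Na algebra_simps)
    then show ?thesis
      using local_deriv_Fin[OF deg d1, of a] Da by (simp add: N_def D_def power2_eq_square)
  qed
  have degND: "degree (N - smult a D) \<le> d"
    using facts degree_smult_le[of a D] by (intro degree_diff_le) auto
  have deg1: "degree N1 \<le> d" "degree D1 \<le> d"
    using degND facts by (simp_all add: N1_def D1_def degree_pcompose)
  have N1: "poly N1 x = poly N (a + x) - a * poly D (a + x)" and D1: "poly D1 x = poly D (a + x)" for x
    by (simp_all add: N1_def D1_def poly_pcompose add.commute)
  have W1: "poly (wronskian D1 N1) x = - poly (wronskian N D) (a + x)" for x
    by (simp add: wronskian_def N1_def D1_def pderiv_pcompose pderiv_pCons pderiv_diff pderiv_smult
        poly_pcompose algebra_simps)
  have N1_0: "coeff N1 0 = 0" using N1[of 0] Na by (simp add: poly_0_coeff_0)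
  have D1_0: "coeff D1 0 = poly D a" using D1[of 0] by (simp add: poly_0_coeff_0)
  \<comment> \<open>Reversal turns the linear coefficient of \<open>N1\<close> into the leading
    coefficient of \<open>P\<close>, so the multiplier is again a quotient of leading
    coefficients.\<close>
  have N1_1: "coeff N1 1 = poly (pderiv N) a - a * poly (pderiv D) a"
  proof -
    have "coeff N1 1 = poly (pderiv N1) 0" by (simp add: poly_0_coeff_0 coeff_pderiv)
    then show ?thesis
      by (simp add: N1_def pderiv_pcompose pderiv_pCons poly_pcompose pderiv_diff pderiv_smult)
  qed
  have N1_1': "coeff N1 1 = local_deriv f (Fin a) * poly D a" using deriv Da N1_1 by simp
  have Qd: "coeff Q d = poly D a" by (simp add: Q_def coeff_reversed_poly D1_0)
  have Pd: "coeff P d = 0" by (simp add: P_def coeff_reversed_poly N1_0)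
  have Pd1: "coeff P (d - 1) = local_deriv f (Fin a) * poly D a"
    using d1 N1_1' by (simp add: P_def coeff_reversed_poly)
  have nz: "P \<noteq> 0" using Pd1 mult(1) Da by auto
  have degQ: "degree Q = d"
    using degree_reversed_poly_le[of d D1] Qd Da le_degree[of Q d] by (simp add: Q_def)
  have "degree P \<le> d" by (simp add: P_def degree_reversed_poly_le)
  moreover have "degree P \<noteq> d" using Pd nz by auto
  moreover have "d - 1 \<le> degree P" using Pd1 mult(1) Da by (intro le_degree) auto
  ultimately have degP: "Suc (degree P) = d" using d1 by linarith
  have "lead_coeff P = local_deriv f (Fin a) * lead_coeff Q"
    using Pd1 Qd degQ degP by (metis diff_Suc_1)
  then have lc: "v (lead_coeff P) < eps v d * v (lead_coeff Q)"
    using mult(2) Qd degQ Da by (simp add: nonarch_absolute_value_axioms nonarch_absolute_value.mult pos_iff)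
  obtain e where e: "d = Suc e" using d1 by (cases d) auto
  note shift = coeff_shift[where n = e, folded e]
  have top: "coeff N1 d = coeff N d - a * coeff D d" "coeff D1 d = coeff D d"
    using shift(1)[OF degND] shift(1)[OF facts(2)] by (simp_all add: N1_def D1_def)
  have "coprime N1 D1"
  proof (subst coprime_iff_no_common_root)
    show "N1 \<noteq> 0" using nz by (auto simp: P_def reversed_poly_def)
    show "\<forall>z. poly N1 z = 0 \<longrightarrow> poly D1 z \<noteq> 0"
      using coprime_poly_0[OF cop] by (auto simp: N1 D1)
  qed
  then have "coprime P Q"
    unfolding P_def Q_def
    by (intro coprime_reversed_poly deg1) (use facts(3) top nz in \<open>auto simp: P_def\<close>)
  then obtain z where z: "poly (wronskian Q P) (z 0) = 0" "\<And>n. poly P (z n) \<noteq> 0"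
      "\<And>n. z (Suc n) = poly Q (z n) / poly P (z n)"
    and lim: "filterlim (\<lambda>n. v (z n)) at_top sequentially"
    using exists_escaping_critical_orbit[OF char degQ degP d _ lc] by metis
  \<comment> \<open>The coordinate change from finite \<open>z\<close> back to the original line. It
    never takes the value \<open>Fin a\<close>, which makes the attraction strict.\<close>
  define pt where "pt z = (if z = 0 then Infty else Fin (a + 1 / z))" for z
  have step: "rat_map f (pt w) = pt (poly Q w / poly P w)" if P: "poly P w \<noteq> 0" for w
  proof (cases "w = 0")
    case True
    then have "poly P w = coeff N d - a * coeff D d" "poly Q w = coeff D d"
      using top by (simp_all add: P_def Q_def poly_0_coeff_0 coeff_reversed_poly)
    then show ?thesis
      using P True rat_map_Infty[OF deg d1, folded N_def D_def]
      by (simp add: pt_def field_simps del: rat_map.simps)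
  next
    case False
    then show ?thesis
      using P rat_map_Fin[OF deg d1, of "a + 1 / w"]
      by (simp add: pt_def P_def Q_def poly_reversed_poly[OF deg1(1)] poly_reversed_poly[OF deg1(2)]
          N1 D1 N_def D_def field_simps del: rat_map.simps)
  qed
  have "(\<lambda>n. chordal v (pt (z n)) (Fin a)) \<longlonglongrightarrow> 0"
  proof (rule tendsto_sandwich[OF _ _ tendsto_const tendsto_inverse_0_at_top[OF lim]])
    have "\<forall>\<^sub>F n in sequentially. v (z n) > 1" using lim by (simp add: filterlim_at_top_dense)
    then show "\<forall>\<^sub>F n in sequentially. chordal v (pt (z n)) (Fin a) \<le> inverse (v (z n))"
    proof eventually_elim
      case (elim n)
      then have "z n \<noteq> 0" by auto
      then have "chordal v (pt (z n)) (Fin a) = inverse (v (z n)) / (max (v (a + 1 / z n)) 1 * max (v a) 1)"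
        by (simp add: pt_def chordal_def one divide divide_inverse inverse)
      also have "\<dots> \<le> inverse (v (z n)) / 1"
        by (intro divide_left_mono mult_ge1_I) (auto simp: nonneg)
      finally show ?case by simp
    qed
  qed (simp add: chordal_nonneg)
  then have "strictly_attracts v f (Fin a) (pt (z 0))"
    using z step by (intro strictly_attracts_orbit[of f "\<lambda>n. pt (z n)"]) (auto simp: pt_def simp del: rat_map.simps)
  moreover have "critical_point f (pt (z 0))"
  proof (cases "z 0 = 0")
    case True
    \<comment> \<open>Here the critical point is infinity. The terms that the shift by
      \<open>a\<close> adds to the coefficients at \<open>e\<close> are the same multiple of those
      at \<open>d\<close>, so they cancel in the determinant.\<close>
    have "coeff D1 (d - 1) * coeff N1 d - coeff D1 d * coeff N1 (d - 1) = 0"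
      using z(1) True unfolding Q_def P_def by (simp add: poly_wronskian_reversed_poly_0[OF d1])
    moreover have "coeff N1 e = coeff N e - a * coeff D e + of_nat d * a * (coeff N d - a * coeff D d)"
      "coeff D1 e = coeff D e + of_nat d * a * coeff D d"
      using shift(2)[OF degND] shift(2)[OF facts(2)] by (simp_all add: N1_def D1_def)
    ultimately have "coeff N (d - 1) * coeff D d = coeff N d * coeff D (d - 1)"
      unfolding top by (simp add: e algebra_simps)
    then show ?thesis using critical_point_Infty[OF deg d1] True by (simp add: pt_def N_def D_def)
  next
    case False
    then have "poly (wronskian N D) (a + 1 / z 0) = 0"
      using poly_wronskian_reversed_poly[OF deg1 False] z(1) by (simp add: Q_def P_def W1)
    then show ?thesis using critical_point_Fin[OF deg d1] False by (simp add: pt_def N_def D_def)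
  qed
  ultimately show ?thesis by blast
qed

end

theorem theorem1p2:
  fixes v :: "'a :: alg_closed_field \<Rightarrow> real"
    and p d :: nat
    and \<phi> :: "'a poly fract"
    and \<gamma> :: "'a proj_line"
  assumes "nonarch_absolute_value v"
    and "nontrivial_absolute_value v"
    and "complete_absolute_value v"
    and "p = residue_char v"
    and "d \<ge> 2"
    and "CHAR('a) = 0 \<or> CHAR('a) > d"
    and "rat_degree \<phi> = d"
    and "fixed_point \<phi> \<gamma>"
    and "0 < v (multiplier \<phi> \<gamma>)" and "v (multiplier \<phi> \<gamma>) < eps v d"
  shows "\<exists>c. critical_point \<phi> c \<and> strictly_attracts v \<phi> \<gamma> c"
proof -
  interpret alg_closed_nonarch v using assms(1) by (simp add: alg_closed_nonarch_def)
  show ?thesis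
    using assms strictly_attracted_critical_point_Fin strictly_attracted_critical_point_Infty
    by (cases \<gamma>) auto
qed

end
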